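(* Suppose an $s$-stage TVD Runge–Kutta method of order greater than or equal to $d$ is used both for the stage metric terms $\{J_{K^{n,i}}\}_{i=0}^s$ and for the fully-discrete ALE-DG method described in the context, and that the values $\{J_{K^{n,i}}\}_{i=0}^s$ are used to compute the metric terms in the fully-discrete method. Suppose moreover that the solution at time level $t_n$ satisfies $u_h^{n,*}=c$ (on every cell) for a constant $c\in\mathbb R$. Then $u_h^{n,i,*}=c$ (on every cell) for all $i=0,\dots,s$.
   Context: **Moving mesh.** $\Omega\subseteq\mathbb R^d$ is an open convex polyhedron, $t_n<t_{n+1}$ are consecutive time levels in $[0,T]$, $\Delta t=t_{n+1}-t_n$. $\mathcal T_{(t_n)}$ and $\mathcal T_{(t_{n+1})}$ are regular simplicial meshes of $\Omega$ with the same topology (same number of cells, with corresponding cells and vertices, all cells positively oriented with respect to $K_{\rm ref}=\{\boldsymbol\xi\in\mathbb R^d:\xi_\nu\ge0,\ \sum_\nu\xi_\nu\le1\}$). For corresponding vertices $\mathbf v_\ell^n,\mathbf v_\ell^{n+1}$ ($\ell=1,\dots,d+1$) of a cell and $t\in[t_n,t_{n+1}]$ set $\mathbf v_\ell(t)=\mathbf v_\ell^n+\frac{t-t_n}{\Delta t}(\mathbf v_\ell^{n+1}-\mathbf v_\ell^n)$, $K(t)=\operatorname{int}\operatorname{conv}\{\mathbf v_1(t),\dots,\mathbf v_{d+1}(t)\}$, $\mathbf A_{K(t)}=(\mathbf v_2(t)-\mathbf v_1(t),\dots,\mathbf v_{d+1}(t)-\mathbf v_1(t))$, $J_{K(t)}=\det\mathbf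 A_{K(t)}=d!\,|K(t)|$, $\boldsymbol\chi_{K(t)}(\boldsymbol\xi,t)=\mathbf A_{K(t)}\boldsymbol\xi+\mathbf v_1(t)$; $\mathcal T_{(t)}$ is the set of all cells $K(t)$. With $h_{K(t)}$ the diameter of $K(t)$, $\rho_{K(t)}$ the radius of the largest ball contained in $K(t)$, and $h=\max_{t\in[0,T]}\max_{K(t)\in\mathcal T_{(t)}}h_{K(t)}$, it is assumed for all $t\in[0,T]$ that: (A1) $\overline\Omega=\bigcup_{K(t)\in\mathcal T_{(t)}}\overline{K(t)}$; (A2) $J_{K(t)}>0$ for all cells; (A3) there are constants $\kappa,\tau>0$ independent of $h$ with $h_{K(t)}\le\kappa\rho_{K(t)}$ and $h\le\tau h_{K(t)}$ for all cells. The grid velocity, as a function on $K_{\rm ref}$, is $\boldsymbol\omega(t)=\boldsymbol\omega(\boldsymbol\xi,t)=\frac{d}{dt}\boldsymbol\chi_{K(t)}(\boldsymbol\xi,t)$. A star denotes pull-back: $v^*=v\circ\boldsymbol\chi_{K(t)}$. $\mathcal V_h(t)=\{v\in L^2(\Omega):v^*\in P^k(K_{\rm ref})\text{ for all cells}\}$, where $P^k(K_{\rm ref})$ is the space of polynomials of degree at most $k$. $(\cdot,\cdot)_{K_{\rm ref}}$ is the $L^2$ inner product on $K_{\rm ref}$, $\langle\cdot,\cdot\rangle_{\partial K_{\rm ref}}$ that on $\partial K_{\rm ref}$, and $\mathbf n_{K_{\rm ref}}$ is the outward normal of $K_{\rm ref}$. **Flux.** The problem is the scalar conservation law $\partial_tu+\nabla\cdot\boldsymbol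 f(u)=0$ in $\Omega\times(0,T)$ with an initial condition and suitable boundary conditions, where $\boldsymbol f:\mathbb R\to\mathbb R^d$ is a suitable vector field; $\boldsymbol g(\boldsymbol\omega,u)=\boldsymbol f(u)-\boldsymbol\omega u$. The numerical flux $\widehat g(\boldsymbol\omega,u_1,u_2,\mathbf n)$, where $\mathbf n$ is a (not necessarily normalized) normal vector, satisfies: consistency $\widehat g(\boldsymbol\omega,u,u,\mathbf n)=\boldsymbol g(\boldsymbol\omega,u)\cdot\mathbf n$; it is increasing and Lipschitz continuous in $u_1$; it is decreasing and Lipschitz continuous in $u_2$; and $\widehat g(\boldsymbol\omega,u_1,u_2,\mathbf n)=-\widehat g(\boldsymbol\omega,u_2,u_1,-\mathbf n)$. For a number $J$ and a time $t$ put $$\mathcal G(u_h^*,v^*,J,t)=\big(J\mathbf A_{K(t)}^{-1}\boldsymbol g(\boldsymbol\omega(t),u_h^* ),\nabla_{\boldsymbol\xi}v^*\big)_{K_{\rm ref}}-\big\langle\widehat g(\boldsymbol\omega,u_h^{*,\mathrm{int}},u_h^{*,\mathrm{ext}},J\mathbf A_{K(t)}^{-T}\mathbf n_{K_{\rm ref}}),v^{*,\mathrm{int}}\big\rangle_{\partial K_{\rm ref}},$$ where int and ext denote the pulled-back traces from inside and outside the cell. **TVD Runge–Kutta method.** For $u_t=q(u,t)$: $u^{n,0}=u^n$, $u^{n,i}=\sum_{j=0}^{i-1}(\alpha_{ij}u^{n,j}+\Delta t\,\beta_{ij}q(u^{n,j},t_{n+\gamma_j}))$ for $i=1,\dots,s$,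 $u^{n+1}=u^{n,s}$, with $t_{n+\gamma_j}=t_n+\gamma_j\Delta t$, $0\le\gamma_j\le1$, $\alpha_{ij},\beta_{ij}\ge0$, $\alpha_{ij}=0\Rightarrow\beta_{ij}=0$, $\sum_{j=0}^{i-1}\alpha_{ij}=1$. **Stage metric terms.** With $K^{n+\gamma_j}=K(t_{n+\gamma_j})$, $\boldsymbol\omega^{n+\gamma_j}=\boldsymbol\omega(t_{n+\gamma_j})$: $J_{K^{n,0}}=J_{K^n}=J_{K(t_n)}$, $$J_{K^{n,i}}=\sum_{j=0}^{i-1}\Big(\alpha_{ij}J_{K^{n,j}}+\beta_{ij}\Delta t\big(\nabla_{\boldsymbol\xi}\cdot[\mathbf A_{K^{n+\gamma_j}}^{-1}\boldsymbol\omega^{n+\gamma_j}]\big)J_{K^{n,j}}\Big),\quad i=1,\dots,s,$$ and $J_{K^{n+1}}=J_{K^{n,s}}$. This is the Runge–Kutta method applied to the ODE $\frac{d}{dt}J_{K(t)}=(\nabla_{\boldsymbol\xi}\cdot[\mathbf A_{K(t)}^{-1}\boldsymbol\omega])J_{K(t)}$. **Fully-discrete ALE-DG method.** The stage functions $u_h^{n,i,*}$ (on $K_{\rm ref}$, for each cell, polynomials of degree at most $k$) satisfy, for every cell and every $v\in\mathcal V_h(t)$, $(J_{K^{n,0}}u_h^{n,0,*},v^* )_{K_{\rm ref}}=(J_{K^n}u_h^{n,*},v^* )_{K_{\rm ref}}$, for $i=1,\dots,s$ $$(J_{K^{n,i}}u_h^{n,i,*},v^* )_{K_{\rm ref}}=\sum_{j=0}^{i-1}\alpha_{ij}(J_{K^{n,j}}u_h^{n,j,*},v^*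 )_{K_{\rm ref}}+\sum_{j=0}^{i-1}\beta_{ij}\Delta t\,\mathcal G(u_h^{n,j,*},v^*,J_{K^{n,j}},t_{n+\gamma_j}),$$ and $(J_{K^{n+1}}u_h^{n+1,*},v^* )_{K_{\rm ref}}=(J_{K^{n,s}}u_h^{n,s,*},v^* )_{K_{\rm ref}}$.
   Formalization: The stage metric terms J_{K^{n,i}}, i = 1,…,s, are assumed nonzero (otherwise the stage functions are not determined and the claim fails), and "suitable boundary conditions" is taken to mean that the exterior boundary state is c whenever the discrete solution is c. *)

theory Defs
  imports "HOL-Analysis.Analysis"
begin

section \<open>Simplices and the reference cell\<close>

text \<open>
  The \<open>d + 1\<close> local vertices of a simplex in \<open>real ^ 'd\<close> are indexed by \<open>'d option\<close>:
  \<open>None\<close> is the base vertex \<open>v\<^sub>1\<close> and \<open>Some i\<close> is the vertex that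
  spans the \<open>i\<close>-th column of the edge matrix. A simplex is given by its vertex map
  \<open>w :: 'd option \<Rightarrow> real ^ 'd\<close>.
\<close>

definition ref_cell :: "(real ^ 'd) set" where
  "ref_cell = {\<xi>. (\<forall>i. 0 \<le> \<xi> $ i) \<and> (\<Sum>i\<in>UNIV. \<xi> $ i) \<le> 1}"

definition edge_matrix :: "('d option \<Rightarrow> real ^ 'd) \<Rightarrow> real ^ 'd ^ 'd" where
  "edge_matrix w = (\<chi> i j. (w (Some j) - w None) $ i)"

definition ref_map :: "('d option \<Rightarrow> real ^ 'd) \<Rightarrow> real ^ 'd \<Rightarrow> real ^ 'd" where
  "ref_map w \<xi> = edge_matrix w *v \<xi> + w None"

definition cell :: "('d option \<Rightarrow> real ^ 'd) \<Rightarrow> (real ^ 'd) set" where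
  "cell w = interior (convex hull (range w))"

definition inball_radius :: "(real ^ 'd) set \<Rightarrow> real" where
  "inball_radius K = Sup {r. 0 < r \<and> (\<exists>x. ball x r \<subseteq> K)}"

text \<open>The facet of the reference cell opposite to a local vertex.\<close>

definition ref_facet :: "'d option \<Rightarrow> (real ^ 'd) set" where
  "ref_facet l = (case l of
      None \<Rightarrow> {\<xi> \<in> ref_cell. (\<Sum>i\<in>UNIV. \<xi> $ i) = 1}
    | Some i \<Rightarrow> {\<xi> \<in> ref_cell. \<xi> $ i = 0})"

text \<open>
  Outward unit normal of the reference cell on a facet. The facet lies in the hyperplane
  \<open>{\<xi>. ref_normal l \<bullet> \<xi> = ref_offset l}\<close>.
\<close>

definition ref_normal :: "'d option \<Rightarrow> real ^ 'd" where
  "ref_normal l = (case l of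
      None \<Rightarrow> (1 / sqrt (real CARD('d))) *\<^sub>R (\<chi> i. 1)
    | Some i \<Rightarrow> - axis i 1)"

definition ref_offset :: "('d::finite) option \<Rightarrow> real" where
  "ref_offset l = (case l of None \<Rightarrow> 1 / sqrt (real CARD('d)) | Some i \<Rightarrow> 0)"


section \<open>Integrals, derivatives and polynomials on the reference cell\<close>

text \<open>
  Surface measure on the hyperplane \<open>{x. n \<bullet> x = b}\<close>, for a unit vector \<open>n\<close>: the measure of
  a subset \<open>S\<close> is the \<open>d\<close>-dimensional Lebesgue measure of the right prism of height 1
  with base \<open>S\<close>.
\<close>

definition hyperplane_measure :: "real ^ 'd \<Rightarrow> real \<Rightarrow> (real ^ 'd) measure" where
  "hyperplane_measure n b =
     distr (restrict_space lborel {x. b \<le> n \<bullet> x \<and> n \<bullet> x \<le> b + 1}) borel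
       (\<lambda>x. x - (n \<bullet> x - b) *\<^sub>R n)"

definition inner_ref_cell :: "(real ^ 'd \<Rightarrow> 'b::real_inner) \<Rightarrow> (real ^ 'd \<Rightarrow> 'b) \<Rightarrow> real" where
  "inner_ref_cell p q = (LINT \<xi>:ref_cell|lborel. p \<xi> \<bullet> q \<xi>)"

text \<open>
  The \<open>L\<^sup>2\<close> product on the boundary; the integrands may depend on the facet, since the
  normal and the exterior trace do.
\<close>

definition inner_ref_boundary ::
  "('d option \<Rightarrow> real ^ 'd \<Rightarrow> real) \<Rightarrow> ('d option \<Rightarrow> real ^ 'd \<Rightarrow> real) \<Rightarrow> real" where
  "inner_ref_boundary p q =
     (\<Sum>l\<in>UNIV. LINT \<xi>:ref_facet l|hyperplane_measure (ref_normal l) (ref_offset l).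
        p l \<xi> * q l \<xi>)"

definition gradient :: "(real ^ 'd \<Rightarrow> real) \<Rightarrow> real ^ 'd \<Rightarrow> real ^ 'd" where
  "gradient p \<xi> = (\<chi> i. frechet_derivative p (at \<xi>) (axis i 1))"

definition divergence :: "(real ^ 'd \<Rightarrow> real ^ 'd) \<Rightarrow> real ^ 'd \<Rightarrow> real" where
  "divergence F \<xi> = (\<Sum>i\<in>UNIV. frechet_derivative F (at \<xi>) (axis i 1) $ i)"

text \<open>
  Polynomials of total degree at most \<open>k\<close>, as functions on the whole space (the sum ranges
  over the finitely many multi-indices of length at most \<open>k\<close>).
\<close>

definition poly_space :: "nat \<Rightarrow> (real ^ 'd \<Rightarrow> real) set" where
  "poly_space k =
     {p. \<exists>a :: ('d \<Rightarrow> nat) \<Rightarrow> real.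
        p = (\<lambda>\<xi>. \<Sum>m | (\<Sum>i\<in>UNIV. m i) \<le> k. a m * (\<Prod>i\<in>UNIV. (\<xi> $ i) ^ m i))}"


section \<open>The moving mesh\<close>

text \<open>
  Cells are labelled by a finite set \<open>C\<close>; \<open>conn K l\<close> is the global label of the \<open>l\<close>-th
  vertex of cell \<open>K\<close>, and \<open>x\<close> gives the positions of the vertices. The labels \<open>C\<close> and \<open>conn\<close>
  do not depend on time, which expresses that all meshes have the same topology.
\<close>

definition simplicial_mesh ::
  "(real ^ 'd) set \<Rightarrow> 'c set \<Rightarrow> ('c \<Rightarrow> 'd option \<Rightarrow> 'v) \<Rightarrow> ('v \<Rightarrow> real ^ 'd) \<Rightarrow> bool" where
  "simplicial_mesh \<Omega> C conn x \<longleftrightarrow>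
     finite C \<and>
     closure \<Omega> = (\<Union>K\<in>C. closure (cell (x \<circ> conn K))) \<and>
     (\<forall>K\<in>C. det (edge_matrix (x \<circ> conn K)) > 0) \<and>
     (\<forall>K\<in>C. \<forall>K'\<in>C. K \<noteq> K' \<longrightarrow>
        cell (x \<circ> conn K) \<inter> cell (x \<circ> conn K') = {} \<and>
        convex hull (range (x \<circ> conn K)) \<inter> convex hull (range (x \<circ> conn K')) =
          convex hull (x ` (range (conn K) \<inter> range (conn K'))))"

text \<open>
  \<open>tm m\<close> are the time levels and \<open>X m\<close> the vertex positions at time \<open>tm m\<close>. The vertices move
  along straight lines in each time slab \<open>[tm m, tm (m + 1)]\<close>.
\<close>

definition slab_vertices ::
  "(nat \<Rightarrow> real) \<Rightarrow> ('c \<Rightarrow> 'd option \<Rightarrow> 'v) \<Rightarrow> (nat \<Rightarrow> 'v \<Rightarrow> real ^ 'd) \<Rightarrow> nat \<Rightarrow>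
     real \<Rightarrow> 'c \<Rightarrow> 'd option \<Rightarrow> real ^ 'd" where
  "slab_vertices tm conn X m t K l =
     X m (conn K l) +
       ((t - tm m) / (tm (Suc m) - tm m)) *\<^sub>R (X (Suc m) (conn K l) - X m (conn K l))"

definition mesh_size ::
  "nat \<Rightarrow> (nat \<Rightarrow> real) \<Rightarrow> 'c set \<Rightarrow> ('c \<Rightarrow> 'd option \<Rightarrow> 'v) \<Rightarrow> (nat \<Rightarrow> 'v \<Rightarrow> real ^ 'd) \<Rightarrow> real" where
  "mesh_size N tm C conn X =
     Sup {diameter (cell (slab_vertices tm conn X m t K)) | m t K.
            m < N \<and> t \<in> {tm m..tm (Suc m)} \<and> K \<in> C}"

definition moving_mesh ::
  "(real ^ 'd) set \<Rightarrow> real \<Rightarrow> nat \<Rightarrow> (nat \<Rightarrow> real) \<Rightarrow> 'c set \<Rightarrow> ('c \<Rightarrow> 'd option \<Rightarrow> 'v) \<Rightarrow>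
     (nat \<Rightarrow> 'v \<Rightarrow> real ^ 'd) \<Rightarrow> real \<Rightarrow> real \<Rightarrow> bool" where
  "moving_mesh \<Omega> T N tm C conn X \<kappa> \<tau> \<longleftrightarrow>
     open \<Omega> \<and> convex \<Omega> \<and> \<Omega> \<noteq> {} \<and> polyhedron (closure \<Omega>) \<and>
     tm 0 = 0 \<and> tm N = T \<and> (\<forall>m<N. tm m < tm (Suc m)) \<and>
     (\<forall>m\<le>N. simplicial_mesh \<Omega> C conn (X m)) \<and>
     \<kappa> > 0 \<and> \<tau> > 0 \<and>
     (\<forall>m<N. \<forall>t\<in>{tm m..tm (Suc m)}.
        closure \<Omega> = (\<Union>K\<in>C. closure (cell (slab_vertices tm conn X m t K))) \<and>
        (\<forall>K\<in>C. det (edge_matrix (slab_vertices tm conn X m t K)) > 0) \<and>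
        (\<forall>K\<in>C. diameter (cell (slab_vertices tm conn X m t K)) \<le>
                  \<kappa> * inball_radius (cell (slab_vertices tm conn X m t K)) \<and>
                mesh_size N tm C conn X \<le>
                  \<tau> * diameter (cell (slab_vertices tm conn X m t K))))"

text \<open>
  In the following, \<open>P :: real \<Rightarrow> 'c \<Rightarrow> 'd option \<Rightarrow> real ^ 'd\<close> is the vertex motion in one
  time slab, i.e. \<open>P t K l\<close> is the \<open>l\<close>-th vertex of cell \<open>K\<close> at time \<open>t\<close>.
\<close>

definition grid_velocity ::
  "(real \<Rightarrow> 'c \<Rightarrow> 'd option \<Rightarrow> real ^ 'd) \<Rightarrow> real \<Rightarrow> 'c \<Rightarrow> real ^ 'd \<Rightarrow> real ^ 'd" where
  "grid_velocity P t K \<xi> = vector_derivative (\<lambda>r. ref_map (P r K) \<xi>) (at t)"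

text \<open>The function \<open>p\<close> on the reference cell is the pull-back of \<open>v\<close> from the simplex \<open>w\<close>.\<close>

definition pulls_back_to ::
  "('d option \<Rightarrow> real ^ 'd) \<Rightarrow> (real ^ 'd \<Rightarrow> real) \<Rightarrow> (real ^ 'd \<Rightarrow> real) \<Rightarrow> bool" where
  "pulls_back_to w v p \<longleftrightarrow> (AE \<xi> in lebesgue_on ref_cell. v (ref_map w \<xi>) = p \<xi>)"

text \<open>The DG space \<open>V\<^sub>h\<close> on the mesh with cells \<open>W K\<close>, by representatives of its elements.\<close>

definition dg_space ::
  "nat \<Rightarrow> (real ^ 'd) set \<Rightarrow> 'c set \<Rightarrow> ('c \<Rightarrow> 'd option \<Rightarrow> real ^ 'd) \<Rightarrow> (real ^ 'd \<Rightarrow> real) set" where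
  "dg_space k \<Omega> C W =
     {v. v \<in> borel_measurable (lebesgue_on \<Omega>) \<and> integrable (lebesgue_on \<Omega>) (\<lambda>x. (v x)\<^sup>2) \<and>
         (\<forall>K\<in>C. \<exists>p\<in>poly_space k. pulls_back_to (W K) v p)}"


section \<open>Numerical flux\<close>

definition ale_flux :: "(real \<Rightarrow> real ^ 'd) \<Rightarrow> real ^ 'd \<Rightarrow> real \<Rightarrow> real ^ 'd" where
  "ale_flux f \<omega> u = f u - u *\<^sub>R \<omega>"

definition numerical_flux ::
  "(real \<Rightarrow> real ^ 'd) \<Rightarrow> (real ^ 'd \<Rightarrow> real \<Rightarrow> real \<Rightarrow> real ^ 'd \<Rightarrow> real) \<Rightarrow> bool" where
  "numerical_flux f ghat \<longleftrightarrow>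
     (\<forall>\<omega> n. n \<noteq> 0 \<longrightarrow>
        (\<forall>u. ghat \<omega> u u n = ale_flux f \<omega> u \<bullet> n) \<and>
        (\<forall>u2. mono (\<lambda>u1. ghat \<omega> u1 u2 n) \<and>
              (\<exists>L. L-lipschitz_on UNIV (\<lambda>u1. ghat \<omega> u1 u2 n))) \<and>
        (\<forall>u1. antimono (\<lambda>u2. ghat \<omega> u1 u2 n) \<and>
              (\<exists>L. L-lipschitz_on UNIV (\<lambda>u2. ghat \<omega> u1 u2 n))) \<and>
        (\<forall>u1 u2. ghat \<omega> u1 u2 n = - ghat \<omega> u2 u1 (- n)))"


section \<open>Traces and the spatial form\<close>

text \<open>\<open>K'\<close> contains the facet of \<open>K\<close> opposite to the local vertex \<open>l\<close>.\<close>

definition neighbour ::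
  "'c set \<Rightarrow> ('c \<Rightarrow> 'd option \<Rightarrow> 'v) \<Rightarrow> 'c \<Rightarrow> 'd option \<Rightarrow> 'c \<Rightarrow> bool" where
  "neighbour C conn K l K' \<longleftrightarrow>
     K' \<in> C \<and> K' \<noteq> K \<and> conn K ` (UNIV - {l}) \<subseteq> range (conn K')"

definition boundary_facet ::
  "'c set \<Rightarrow> ('c \<Rightarrow> 'd option \<Rightarrow> 'v) \<Rightarrow> 'c \<Rightarrow> 'd option \<Rightarrow> bool" where
  "boundary_facet C conn K l \<longleftrightarrow> (\<nexists>K'. neighbour C conn K l K')"

text \<open>
  A discrete function is given by its pull-backs \<open>u K\<close> to the reference cell. On the facet \<open>l\<close>
  of \<open>K\<close> its exterior trace is the trace from the neighbouring cell (which is unique in a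
  simplicial mesh), read at the same physical point. On the boundary of the domain the exterior
  state \<open>B t u K l \<xi>\<close> is supplied by the treatment \<open>B\<close> of the boundary conditions; it may depend
  on time and on the whole discrete function, so inflow data, outflow and periodic conditions
  are all covered.
\<close>

definition exterior_trace ::
  "(real \<Rightarrow> ('c \<Rightarrow> real ^ 'd \<Rightarrow> real) \<Rightarrow> 'c \<Rightarrow> 'd option \<Rightarrow> real ^ 'd \<Rightarrow> real) \<Rightarrow>
     'c set \<Rightarrow> ('c \<Rightarrow> 'd option \<Rightarrow> 'v) \<Rightarrow> (real \<Rightarrow> 'c \<Rightarrow> 'd option \<Rightarrow> real ^ 'd) \<Rightarrow> real \<Rightarrow>
     ('c \<Rightarrow> real ^ 'd \<Rightarrow> real) \<Rightarrow> 'c \<Rightarrow> 'd option \<Rightarrow> real ^ 'd \<Rightarrow> real" where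
  "exterior_trace B C conn P t u K l \<xi> =
     (if boundary_facet C conn K l then B t u K l \<xi>
      else (let K' = (SOME K'. neighbour C conn K l K')
            in u K' (matrix_inv (edge_matrix (P t K')) *v (ref_map (P t K) \<xi> - P t K' None))))"

definition boundary_preserves_const ::
  "(real \<Rightarrow> ('c \<Rightarrow> real ^ 'd \<Rightarrow> real) \<Rightarrow> 'c \<Rightarrow> 'd option \<Rightarrow> real ^ 'd \<Rightarrow> real) \<Rightarrow>
     'c set \<Rightarrow> ('c \<Rightarrow> 'd option \<Rightarrow> 'v) \<Rightarrow> real set \<Rightarrow> real \<Rightarrow> bool" where
  "boundary_preserves_const B C conn I c \<longleftrightarrow>
     (\<forall>t\<in>I. \<forall>u. (\<forall>K\<in>C. \<forall>\<xi>\<in>ref_cell. u K \<xi> = c) \<longrightarrow>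
        (\<forall>K\<in>C. \<forall>l. boundary_facet C conn K l \<longrightarrow> (\<forall>\<xi>\<in>ref_facet l. B t u K l \<xi> = c)))"

text \<open>The spatial form of the cell \<open>K\<close> for a test function with pull-back \<open>p\<close>.\<close>

definition dg_form ::
  "(real \<Rightarrow> real ^ 'd) \<Rightarrow> (real ^ 'd \<Rightarrow> real \<Rightarrow> real \<Rightarrow> real ^ 'd \<Rightarrow> real) \<Rightarrow>
     (real \<Rightarrow> ('c \<Rightarrow> real ^ 'd \<Rightarrow> real) \<Rightarrow> 'c \<Rightarrow> 'd option \<Rightarrow> real ^ 'd \<Rightarrow> real) \<Rightarrow>
     'c set \<Rightarrow> ('c \<Rightarrow> 'd option \<Rightarrow> 'v) \<Rightarrow> (real \<Rightarrow> 'c \<Rightarrow> 'd option \<Rightarrow> real ^ 'd) \<Rightarrow> 'c \<Rightarrow>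
     ('c \<Rightarrow> real ^ 'd \<Rightarrow> real) \<Rightarrow> (real ^ 'd \<Rightarrow> real) \<Rightarrow> real \<Rightarrow> real \<Rightarrow> real" where
  "dg_form f ghat B C conn P K u p J t =
     inner_ref_cell
       (\<lambda>\<xi>. J *\<^sub>R (matrix_inv (edge_matrix (P t K)) *v ale_flux f (grid_velocity P t K \<xi>) (u K \<xi>)))
       (gradient p) -
     inner_ref_boundary
       (\<lambda>l \<xi>. ghat (grid_velocity P t K \<xi>) (u K \<xi>) (exterior_trace B C conn P t u K l \<xi>)
                (J *\<^sub>R (transpose (matrix_inv (edge_matrix (P t K))) *v ref_normal l)))
       (\<lambda>l. p)"


section \<open>Runge--Kutta methods\<close>

definition tvd_runge_kutta ::
  "nat \<Rightarrow> (nat \<Rightarrow> nat \<Rightarrow> real) \<Rightarrow> (nat \<Rightarrow> nat \<Rightarrow> real) \<Rightarrow> (nat \<Rightarrow> real) \<Rightarrow> bool" where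
  "tvd_runge_kutta s \<alpha> \<beta> \<gamma> \<longleftrightarrow>
     s \<ge> 1 \<and>
     (\<forall>j<s. 0 \<le> \<gamma> j \<and> \<gamma> j \<le> 1) \<and>
     (\<forall>i\<in>{1..s}. (\<forall>j<i. 0 \<le> \<alpha> i j \<and> 0 \<le> \<beta> i j \<and> (\<alpha> i j = 0 \<longrightarrow> \<beta> i j = 0)) \<and>
                 (\<Sum>j<i. \<alpha> i j) = 1)"

text \<open>
  The order is defined through systems of \<open>m\<close> ordinary differential equations with arbitrary
  \<open>m\<close>. States are sequences of which only the first \<open>m\<close> components matter, and \<open>q y t l\<close>
  is the \<open>l\<close>-th component of the right-hand side.
\<close>

definition rk_stages ::
  "nat \<Rightarrow> (nat \<Rightarrow> nat \<Rightarrow> real) \<Rightarrow> (nat \<Rightarrow> nat \<Rightarrow> real) \<Rightarrow> (nat \<Rightarrow> real) \<Rightarrow>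
     ((nat \<Rightarrow> real) \<Rightarrow> real \<Rightarrow> nat \<Rightarrow> real) \<Rightarrow> real \<Rightarrow> real \<Rightarrow> (nat \<Rightarrow> real) \<Rightarrow>
     (nat \<Rightarrow> nat \<Rightarrow> real) \<Rightarrow> bool" where
  "rk_stages s \<alpha> \<beta> \<gamma> q dt t0 y0 Y \<longleftrightarrow>
     Y 0 = y0 \<and>
     (\<forall>i\<in>{1..s}. \<forall>l. Y i l =
        (\<Sum>j<i. \<alpha> i j * Y j l + dt * \<beta> i j * q (Y j) (t0 + \<gamma> j * dt) l))"

text \<open>\<open>F\<close> is \<open>r\<close> times continuously differentiable in the variables \<open>x 0, \<dots>, x (M - 1)\<close>.\<close>

primrec C_k_in_vars :: "nat \<Rightarrow> nat \<Rightarrow> ((nat \<Rightarrow> real) \<Rightarrow> real) \<Rightarrow> bool" where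
  "C_k_in_vars M 0 F \<longleftrightarrow> continuous_on UNIV F"
| "C_k_in_vars M (Suc r) F \<longleftrightarrow>
     continuous_on UNIV F \<and>
     (\<forall>i<M. (\<forall>x. (\<lambda>z. F (x(i := z))) differentiable (at (x i))) \<and>
            C_k_in_vars M r (\<lambda>x. deriv (\<lambda>z. F (x(i := z))) (x i)))"

text \<open>
  A smooth right-hand side that depends only on the first \<open>m\<close> components of the state and on
  time; smoothness is joint, time being the variable with index \<open>m\<close>.
\<close>

definition smooth_rhs :: "nat \<Rightarrow> ((nat \<Rightarrow> real) \<Rightarrow> real \<Rightarrow> nat \<Rightarrow> real) \<Rightarrow> bool" where
  "smooth_rhs m q \<longleftrightarrow>
     (\<forall>l<m. (\<forall>y y' t. (\<forall>j<m. y j = y' j) \<longrightarrow> q y t l = q y' t l) \<and>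
            (\<forall>r. C_k_in_vars (Suc m) r (\<lambda>x. q x (x m) l)))"

text \<open>Order at least \<open>p\<close>: the error of one step of length \<open>dt\<close> is \<open>O(dt ^ (p + 1))\<close>.\<close>

definition rk_order_at_least ::
  "nat \<Rightarrow> (nat \<Rightarrow> nat \<Rightarrow> real) \<Rightarrow> (nat \<Rightarrow> nat \<Rightarrow> real) \<Rightarrow> (nat \<Rightarrow> real) \<Rightarrow> nat \<Rightarrow> bool" where
  "rk_order_at_least s \<alpha> \<beta> \<gamma> p \<longleftrightarrow>
     (\<forall>m q t0 \<delta> y Y.
        smooth_rhs m q \<longrightarrow> \<delta> > 0 \<longrightarrow>
        (\<forall>l<m. \<forall>t\<in>{t0..t0 + \<delta>}.
           ((\<lambda>r. y r l) has_real_derivative q (y t) t l) (at t within {t0..t0 + \<delta>})) \<longrightarrow>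
        (\<forall>dt. rk_stages s \<alpha> \<beta> \<gamma> q dt t0 (y t0) (Y dt)) \<longrightarrow>
        (\<forall>l<m. \<exists>E. \<forall>\<^sub>F dt in at_right 0. \<bar>y (t0 + dt) l - Y dt s l\<bar> \<le> E * dt ^ (p + 1)))"


section \<open>Stage metric terms and the fully-discrete method\<close>

text \<open>
  The divergence below is constant on the reference cell because the grid velocity is affine,
  so that requiring the recursion at every point is the recursion for the numbers \<open>J i K\<close>.
  The stage equations of \<open>ale_dg_step\<close> determine \<open>u i K\<close> if and only if \<open>J i K \<noteq> 0\<close>.
\<close>

definition stage_metric_terms ::
  "nat \<Rightarrow> (nat \<Rightarrow> nat \<Rightarrow> real) \<Rightarrow> (nat \<Rightarrow> nat \<Rightarrow> real) \<Rightarrow> (nat \<Rightarrow> real) \<Rightarrow> real \<Rightarrow> real \<Rightarrow>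
     'c set \<Rightarrow> (real \<Rightarrow> 'c \<Rightarrow> 'd option \<Rightarrow> real ^ 'd) \<Rightarrow> (nat \<Rightarrow> 'c \<Rightarrow> real) \<Rightarrow> bool" where
  "stage_metric_terms s \<alpha> \<beta> \<gamma> dt tn C P J \<longleftrightarrow>
     (\<forall>K\<in>C.
        J 0 K = det (edge_matrix (P tn K)) \<and>
        (\<forall>i\<in>{1..s}. \<forall>\<xi>\<in>ref_cell.
           J i K = (\<Sum>j<i. \<alpha> i j * J j K + \<beta> i j * dt *
             divergence (\<lambda>\<eta>. matrix_inv (edge_matrix (P (tn + \<gamma> j * dt) K)) *v
                                grid_velocity P (tn + \<gamma> j * dt) K \<eta>) \<xi> * J j K)))"

text \<open>
  \<open>un\<close>, \<open>u i\<close> and \<open>un1\<close> are the pulled-back solutions at time level \<open>n\<close>, at stage \<open>i\<close> and at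
  time level \<open>n + 1\<close>. The metric terms at the two time levels are \<open>det (edge_matrix (P tn K))\<close>
  and \<open>J s K\<close>.
\<close>

definition ale_dg_step ::
  "nat \<Rightarrow> (nat \<Rightarrow> nat \<Rightarrow> real) \<Rightarrow> (nat \<Rightarrow> nat \<Rightarrow> real) \<Rightarrow> (nat \<Rightarrow> real) \<Rightarrow> real \<Rightarrow> real \<Rightarrow>
     nat \<Rightarrow> (real ^ 'd) set \<Rightarrow>
     (real \<Rightarrow> real ^ 'd) \<Rightarrow> (real ^ 'd \<Rightarrow> real \<Rightarrow> real \<Rightarrow> real ^ 'd \<Rightarrow> real) \<Rightarrow>
     (real \<Rightarrow> ('c \<Rightarrow> real ^ 'd \<Rightarrow> real) \<Rightarrow> 'c \<Rightarrow> 'd option \<Rightarrow> real ^ 'd \<Rightarrow> real) \<Rightarrow>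
     'c set \<Rightarrow> ('c \<Rightarrow> 'd option \<Rightarrow> 'v) \<Rightarrow> (real \<Rightarrow> 'c \<Rightarrow> 'd option \<Rightarrow> real ^ 'd) \<Rightarrow>
     (nat \<Rightarrow> 'c \<Rightarrow> real) \<Rightarrow> ('c \<Rightarrow> real ^ 'd \<Rightarrow> real) \<Rightarrow> (nat \<Rightarrow> 'c \<Rightarrow> real ^ 'd \<Rightarrow> real) \<Rightarrow>
     ('c \<Rightarrow> real ^ 'd \<Rightarrow> real) \<Rightarrow> bool" where
  "ale_dg_step s \<alpha> \<beta> \<gamma> dt tn k \<Omega> f ghat B C conn P J un u un1 \<longleftrightarrow>
     (\<forall>K\<in>C. un K \<in> poly_space k \<and> un1 K \<in> poly_space k \<and> (\<forall>i\<le>s. u i K \<in> poly_space k)) \<and>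
     (\<forall>t\<in>{tn..tn + dt}. \<forall>v\<in>dg_space k \<Omega> C (P t). \<forall>K\<in>C. \<forall>p\<in>poly_space k.
        pulls_back_to (P t K) v p \<longrightarrow>
        inner_ref_cell (\<lambda>\<xi>. J 0 K * u 0 K \<xi>) p =
          inner_ref_cell (\<lambda>\<xi>. det (edge_matrix (P tn K)) * un K \<xi>) p \<and>
        (\<forall>i\<in>{1..s}.
           inner_ref_cell (\<lambda>\<xi>. J i K * u i K \<xi>) p =
             (\<Sum>j<i. \<alpha> i j * inner_ref_cell (\<lambda>\<xi>. J j K * u j K \<xi>) p) +
             (\<Sum>j<i. \<beta> i j * dt *
                dg_form f ghat B C conn P K (u j) p (J j K) (tn + \<gamma> j * dt))) \<and>
        inner_ref_cell (\<lambda>\<xi>. J s K * un1 K \<xi>) p =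
          inner_ref_cell (\<lambda>\<xi>. J s K * u s K \<xi>) p)"

end

theory Submission
  imports Defs
begin

text \<open>
  By induction on the stage. If all earlier stage functions equal \<open>c\<close>, then interior and exterior
  traces agree, so by consistency the flux term of a stage is the integral over the boundary of
  \<open>p F \<bullet> n\<close> with the affine field \<open>F = J A\<^sup>-\<^sup>1 (f c - c \<omega>)\<close>. The divergence theorem on the
  reference cell turns the spatial form into \<open>- div F \<integral> p = c J div (A\<^sup>-\<^sup>1 \<omega>) \<integral> p\<close>, and the stage
  equation becomes \<open>c\<close> times the recursion of the metric terms, that is
  \<open>J\<^sub>i \<integral> u\<^sub>i p = J\<^sub>i c \<integral> p\<close> for all polynomials \<open>p\<close>. Testing with \<open>p = u\<^sub>i - c\<close> concludes.
\<close>

section \<open>Integration along lines transversal to a hyperplane\<close>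

text \<open>Surface integrals are taken with respect to \<open>hyperplane_measure\<close>, a
  push-forward of Lebesgue measure on a slab of height 1, so the divergence theorem has to be built
  from that measure. Coordinate direction \<open>i\<close> is normal to the facet
  \<open>Some i\<close> but in general meets the facet \<open>None\<close> obliquely, which is why
  volume integrals are decomposed along lines in an arbitrary transversal direction. In the field
  \<open>F\<close>, the value \<open>f c\<close> enters only the constant part and leaves no trace
  in the divergence, so only the grid velocity survives. The cancellation is exact because the
  spatial form and the metric recursion carry the same stage value of \<open>J\<close> and the same
  stage time. Nonvanishing of the stage values of \<open>J\<close> enters twice: consistency of the
  numerical flux is given only for nonzero normals, here J A^-T n, and the final test divides by
  \<open>J\<close>.\<close>

lemma nn_integral_lborel_translate:
  fixes h :: "'a::euclidean_space \<Rightarrow> ennreal"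
  assumes [measurable]: "h \<in> borel_measurable borel"
  shows "(\<integral>\<^sup>+x. h (x + a) \<partial>lborel) = (\<integral>\<^sup>+x. h x \<partial>lborel)"
proof -
  have "(\<integral>\<^sup>+x. h x \<partial>lborel) = (\<integral>\<^sup>+x. h x \<partial>distr lborel borel ((+) a))"
    by (simp add: lborel_distr_plus)
  also have "\<dots> = (\<integral>\<^sup>+x. h (x + a) \<partial>lborel)"
    by (subst nn_integral_distr) (auto simp: add.commute)
  finally show ?thesis ..
qed

text \<open>
  Uniqueness of the translation invariant measure: \<open>U\<close> is symmetric and invariant under \<open>L\<close>, and
  evaluating \<open>\<integral>\<integral> 1\<^sub>A(x) 1\<^sub>U(x - L y) dx dy\<close> in both orders compares the measures of \<open>A\<close>
  and of its preimage.
\<close>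

lemma lborel_distr_linear_involution:
  fixes L :: "'a::euclidean_space \<Rightarrow> 'a"
  assumes lin: "linear L" and LL: "\<And>x. L (L x) = x"
  shows "distr lborel borel L = lborel"
proof (rule measure_eqI)
  fix A assume "A \<in> sets (distr lborel borel L)"
  then have A [measurable]: "A \<in> sets borel" by simp
  have contL: "continuous_on UNIV L"
    using lin by (simp add: linear_continuous_on linear_linear)
  then have [measurable]: "L \<in> borel_measurable borel"
    by (rule borel_measurable_continuous_onI)
  \<comment> \<open>Intersecting with the preimage makes \<open>U\<close> invariant, as the
    involution swaps the two factors. Openness around 0 and boundedness give it positive finite
    measure, so it can be cancelled at the end.\<close>
  define U where "U = ball 0 1 \<inter> L -` ball 0 1"
  have "open U"
    unfolding U_def by (intro open_Int open_vimage contL) auto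
  then have [measurable]: "U \<in> sets borel" by simp
  have U: "L y \<in> U \<longleftrightarrow> y \<in> U" "- y \<in> U \<longleftrightarrow> y \<in> U" for y
    by (auto simp: U_def LL linear_neg[OF lin])
  have "0 \<in> U"
    by (simp add: U_def linear_0[OF lin])
  then have "\<not> negligible U"
    using open_not_negligible \<open>open U\<close> by blast
  then have pos: "emeasure lborel U \<noteq> 0"
    by (auto simp: negligible_iff_null_sets null_sets_def)
  have "bounded U"
    unfolding U_def by (rule bounded_subset[OF bounded_ball]) auto
  then have fin: "emeasure lborel U < \<infinity>"
    using emeasure_bounded_finite by simp
  have inner: "(\<integral>\<^sup>+y. indicator U (x - L y) \<partial>lborel) = emeasure lborel U" for x
  proof -
    have "indicator U (x - L y) = (indicator U (y + - L x) :: ennreal)" for y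
      using U(1)[of "y - L x"] U(2)[of "x - L y"]
      by (auto simp: indicator_def linear_diff[OF lin] LL)
    then have "(\<integral>\<^sup>+y. indicator U (x - L y) \<partial>lborel) = (\<integral>\<^sup>+y. indicator U (y + - L x) \<partial>lborel)"
      by simp
    also have "\<dots> = emeasure lborel U"
      by (subst nn_integral_lborel_translate) auto
    finally show ?thesis .
  qed
  have outer: "(\<integral>\<^sup>+x. indicator A x * indicator U (x - L y) \<partial>lborel) =
      (\<integral>\<^sup>+x. indicator A (x + L y) * indicator U x \<partial>lborel)" for y
    using nn_integral_lborel_translate[of "\<lambda>x. indicator A x * indicator U (x - L y)" "L y"] by simp
  have preimage: "(\<integral>\<^sup>+y. indicator A (x + L y) \<partial>lborel) = emeasure (distr lborel borel L) A" for x
  proof -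
    have "(\<integral>\<^sup>+y. indicator A (x + L y) \<partial>lborel) = (\<integral>\<^sup>+y. indicator A (L (y + L x)) \<partial>lborel)"
      by (simp add: linear_add[OF lin] LL add.commute)
    also have "\<dots> = (\<integral>\<^sup>+y. indicator A (L y) \<partial>lborel)"
      by (rule nn_integral_lborel_translate[where h = "\<lambda>y. indicator A (L y)"]) measurable
    also have "\<dots> = (\<integral>\<^sup>+y. indicator A y \<partial>distr lborel borel L)"
      by (rule nn_integral_distr[symmetric]) auto
    finally show ?thesis by simp
  qed
  have "emeasure lborel U * emeasure lborel A =
      (\<integral>\<^sup>+x. indicator A x * (\<integral>\<^sup>+y. indicator U (x - L y) \<partial>lborel) \<partial>lborel)"
    unfolding inner by (subst nn_integral_multc) (auto simp: mult.commute)
  also have "\<dots> = (\<integral>\<^sup>+x. \<integral>\<^sup>+y. indicator A x * indicator U (x - L y) \<partial>lborel \<partial>lborel)"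
    by (subst nn_integral_cmult) auto
  also have "\<dots> = (\<integral>\<^sup>+y. \<integral>\<^sup>+x. indicator A x * indicator U (x - L y) \<partial>lborel \<partial>lborel)"
    by (rule lborel_pair.Fubini'[symmetric]) measurable
  also have "\<dots> = (\<integral>\<^sup>+y. \<integral>\<^sup>+x. indicator A (x + L y) * indicator U x \<partial>lborel \<partial>lborel)"
    unfolding outer ..
  also have "\<dots> = (\<integral>\<^sup>+x. \<integral>\<^sup>+y. indicator A (x + L y) * indicator U x \<partial>lborel \<partial>lborel)"
    by (rule lborel_pair.Fubini') measurable
  also have "\<dots> = (\<integral>\<^sup>+x. emeasure (distr lborel borel L) A * indicator U x \<partial>lborel)"
    by (subst nn_integral_multc) (auto simp: preimage)
  also have "\<dots> = emeasure lborel U * emeasure (distr lborel borel L) A"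
    by (subst nn_integral_cmult) (auto simp: mult.commute)
  finally show "emeasure (distr lborel borel L) A = emeasure lborel A"
    using pos fin by (auto simp: ennreal_mult_cancel_left)
qed simp

text \<open>The linear part reverses the sign of \<open>n \<bullet> x\<close> because
  \<open>n \<bullet> q = - 2\<close>, hence is its own inverse; the offset \<open>b\<close> only
  contributes a translation along \<open>q\<close>.\<close>

lemma lborel_distr_oblique_reflection:
  fixes n q :: "'a::euclidean_space"
  assumes nq: "n \<bullet> q = - 2"
  shows "distr lborel borel (\<lambda>x. x + (n \<bullet> x - b) *\<^sub>R q) = lborel"
proof -
  define L where "L x = x + (n \<bullet> x) *\<^sub>R q" for x
  have lin: "linear L"
    by (rule linearI) (auto simp: L_def inner_add_right scaleR_add_left scaleR_add_right)
  have LL: "L (L x) = x" for x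
    by (simp add: L_def inner_add_right nq algebra_simps)
  have [measurable]: "L \<in> borel_measurable borel"
    using lin by (intro borel_measurable_continuous_onI) (simp add: linear_continuous_on linear_linear)
  have "distr lborel borel (\<lambda>x. x + (n \<bullet> x - b) *\<^sub>R q) =
      distr (distr lborel borel L) borel ((+) ((- b) *\<^sub>R q))"
    by (subst distr_distr) (auto simp: o_def L_def algebra_simps)
  then show ?thesis
    by (simp add: lborel_distr_linear_involution[OF lin LL] lborel_distr_plus)
qed

text \<open>Along the line, \<open>n \<bullet> x\<close> changes at the constant rate
  \<open>n \<bullet> e\<close>, so a slab of thickness 1 is crossed in a parameter length that is
  the reciprocal of the absolute rate.\<close>

lemma nn_integral_slab_line:
  fixes n e z :: "real ^ 'd"
  assumes ne: "n \<bullet> e \<noteq> 0"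
  shows "(\<integral>\<^sup>+s. indicator {x. a \<le> n \<bullet> x \<and> n \<bullet> x \<le> a + 1} (z + s *\<^sub>R e) \<partial>lborel) =
    ennreal (1 / \<bar>n \<bullet> e\<bar>)"
proof -
  let ?I = "\<integral>\<^sup>+s. indicator {a..a+1} (n \<bullet> z + (n \<bullet> e) * s) \<partial>lborel"
  have "(\<integral>\<^sup>+s. indicator {a..a+1} s \<partial>lborel) = ennreal \<bar>n \<bullet> e\<bar> * ?I"
    by (rule nn_integral_real_affine) (use ne in auto)
  then have *: "1 = ennreal \<bar>n \<bullet> e\<bar> * ?I"
    by simp
  have "ennreal (1 / \<bar>n \<bullet> e\<bar>) = ennreal (1 / \<bar>n \<bullet> e\<bar>) * (ennreal \<bar>n \<bullet> e\<bar> * ?I)"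
    by (subst *[symmetric]) simp
  also have "\<dots> = ?I"
    unfolding mult.assoc[symmetric] using ne by (simp flip: ennreal_mult)
  also have "?I = (\<integral>\<^sup>+s. indicator {x. a \<le> n \<bullet> x \<and> n \<bullet> x \<le> a + 1} (z + s *\<^sub>R e) \<partial>lborel)"
    by (rule nn_integral_cong) (auto simp: indicator_def inner_add_right mult.commute)
  finally show ?thesis ..
qed

lemma closed_slab:
  fixes n :: "real ^ 'd"
  shows "closed {x. b \<le> n \<bullet> x \<and> n \<bullet> x \<le> b + 1}"
  by (intro closed_Collect_conj closed_Collect_le continuous_intros)

text \<open>
  The projection along \<open>n\<close> onto the hyperplane differs only by a multiple of \<open>e\<close> from the
  measure-preserving reflection \<open>R\<close> along \<open>n + e / (n \<bullet> e)\<close>, which maps the slab above the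
  hyperplane to the slab below it.
\<close>

lemma cavalieri_oblique_measure:
  fixes n e :: "real ^ 'd" and b :: real
  assumes n: "norm n = 1" and ne: "n \<bullet> e \<noteq> 0"
  defines "M \<equiv> restrict_space lborel {x. b \<le> n \<bullet> x \<and> n \<bullet> x \<le> b + 1}"
  shows "distr (M \<Otimes>\<^sub>M lborel) borel (\<lambda>(x, s). x - (n \<bullet> x - b) *\<^sub>R n + s *\<^sub>R e) =
    density lborel (\<lambda>_. ennreal (1 / \<bar>n \<bullet> e\<bar>))"
proof (rule measure_eqI)
  fix A assume "A \<in> sets (distr (M \<Otimes>\<^sub>M lborel) borel (\<lambda>(x, s). x - (n \<bullet> x - b) *\<^sub>R n + s *\<^sub>R e))"
  then have [measurable]: "A \<in> sets borel" by simp
  have [measurable]: "{x. a \<le> n \<bullet> x \<and> n \<bullet> x \<le> a + 1} \<in> sets borel" for a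
    using closed_slab by (rule borel_closed)
  have Mm: "f \<in> borel_measurable M" if "f \<in> borel_measurable borel"
    for f :: "real ^ 'd \<Rightarrow> 'x::topological_space"
    using that by (simp add: M_def measurable_restrict_space1)
  have [measurable]: "(\<lambda>x. x) \<in> borel_measurable M"
    by (rule Mm) simp
  have [measurable]: "(\<lambda>(x, s). x - (n \<bullet> x - b) *\<^sub>R n + s *\<^sub>R e) \<in> borel_measurable (M \<Otimes>\<^sub>M lborel)"
    by measurable
  let ?S = "\<lambda>a x. indicator {x. a \<le> n \<bullet> x \<and> n \<bullet> x \<le> a + 1} x :: ennreal"
  define q where "q = - n - (1 / (n \<bullet> e)) *\<^sub>R e"
  have nn: "n \<bullet> n = 1"
    using n by (simp add: norm_eq_1)
  have nq: "n \<bullet> q = - 2"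
    using ne by (simp add: q_def inner_diff_right nn)
  define R where "R x = x + (n \<bullet> x - b) *\<^sub>R q" for x
  have [measurable]: "R \<in> borel_measurable borel"
    unfolding R_def by measurable
  have nR: "n \<bullet> R x = 2 * b - n \<bullet> x" for x
    by (simp add: R_def inner_add_right nq algebra_simps)
  have proj: "x - (n \<bullet> x - b) *\<^sub>R n + s *\<^sub>R e = R x + (s + (n \<bullet> x - b) / (n \<bullet> e)) *\<^sub>R e" for x s
    by (simp add: R_def q_def scaleR_diff_right scaleR_add_left)
  define G where "G z = (\<integral>\<^sup>+s. indicator A (z + s *\<^sub>R e) \<partial>lborel) * ?S (b - 1) z" for z
  have [measurable]: "G \<in> borel_measurable borel"
    unfolding G_def by measurable
  have "emeasure (distr (M \<Otimes>\<^sub>M lborel) borel (\<lambda>(x, s). x - (n \<bullet> x - b) *\<^sub>R n + s *\<^sub>R e)) A =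
      (\<integral>\<^sup>+z. indicator A z \<partial>distr (M \<Otimes>\<^sub>M lborel) borel (\<lambda>(x, s). x - (n \<bullet> x - b) *\<^sub>R n + s *\<^sub>R e))"
    by simp
  also have "\<dots> = (\<integral>\<^sup>+z. indicator A (case z of (x, s) \<Rightarrow> x - (n \<bullet> x - b) *\<^sub>R n + s *\<^sub>R e)
      \<partial>(M \<Otimes>\<^sub>M lborel))"
    by (rule nn_integral_distr) auto
  also have "\<dots> = (\<integral>\<^sup>+x. \<integral>\<^sup>+s. indicator A (x - (n \<bullet> x - b) *\<^sub>R n + s *\<^sub>R e) \<partial>lborel \<partial>M)"
    by (subst lborel.nn_integral_fst[symmetric]) auto
  \<comment> \<open>The shift \<open>(n \<bullet> x - b) / (n \<bullet> e)\<close> by which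
    \<open>R x\<close> misses the projection lies along the line, so translation invariance in
    \<open>s\<close> removes it.\<close>
  also have "\<dots> = (\<integral>\<^sup>+x. (\<integral>\<^sup>+s. indicator A (R x + s *\<^sub>R e) \<partial>lborel) \<partial>M)"
    unfolding proj
    by (subst nn_integral_lborel_translate[where h = "\<lambda>s. indicator A (R _ + s *\<^sub>R e)"]) auto
  also have "\<dots> = (\<integral>\<^sup>+x. (\<integral>\<^sup>+s. indicator A (R x + s *\<^sub>R e) \<partial>lborel) * ?S b x \<partial>lborel)"
    unfolding M_def by (rule nn_integral_restrict_space) simp
  also have "\<dots> = (\<integral>\<^sup>+x. G (R x) \<partial>lborel)"
    by (rule nn_integral_cong) (auto simp: G_def nR indicator_def)
  also have "\<dots> = (\<integral>\<^sup>+x. G x \<partial>distr lborel borel R)"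
    by (rule nn_integral_distr[symmetric]) auto
  also have "\<dots> = (\<integral>\<^sup>+x. G x \<partial>lborel)"
    using lborel_distr_oblique_reflection[OF nq, of b] by (simp add: R_def[abs_def])
  also have "\<dots> = (\<integral>\<^sup>+z. \<integral>\<^sup>+s. indicator A (z + s *\<^sub>R e) * ?S (b - 1) z \<partial>lborel \<partial>lborel)"
    unfolding G_def by (subst nn_integral_multc) auto
  also have "\<dots> = (\<integral>\<^sup>+s. \<integral>\<^sup>+z. indicator A (z + s *\<^sub>R e) * ?S (b - 1) z \<partial>lborel \<partial>lborel)"
    by (rule lborel_pair.Fubini'[symmetric]) measurable
  \<comment> \<open>Shifting \<open>z\<close> by \<open>s *\<^sub>R e\<close> frees the indicator of
    \<open>A\<close> from \<open>s\<close>; what remains of the integral over \<open>s\<close> is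
    the parameter length that a line spends in the slab.\<close>
  also have "\<dots> = (\<integral>\<^sup>+s. \<integral>\<^sup>+z. indicator A z * ?S (b - 1) (z + s *\<^sub>R (- e)) \<partial>lborel \<partial>lborel)"
  proof (rule nn_integral_cong)
    fix s :: real
    show "(\<integral>\<^sup>+z. indicator A (z + s *\<^sub>R e) * ?S (b - 1) z \<partial>lborel) =
        (\<integral>\<^sup>+z. indicator A z * ?S (b - 1) (z + s *\<^sub>R (- e)) \<partial>lborel)"
      using nn_integral_lborel_translate[of "\<lambda>z. indicator A z * ?S (b - 1) (z + s *\<^sub>R (- e))" "s *\<^sub>R e"]
      by simp
  qed
  also have "\<dots> = (\<integral>\<^sup>+z. \<integral>\<^sup>+s. indicator A z * ?S (b - 1) (z + s *\<^sub>R (- e)) \<partial>lborel \<partial>lborel)"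
    by (rule lborel_pair.Fubini') measurable
  also have "\<dots> = (\<integral>\<^sup>+z. indicator A z * ennreal (1 / \<bar>n \<bullet> e\<bar>) \<partial>lborel)"
    by (subst nn_integral_cmult, measurable, subst nn_integral_slab_line) (use ne in auto)
  also have "\<dots> = emeasure (density lborel (\<lambda>_. ennreal (1 / \<bar>n \<bullet> e\<bar>))) A"
    by (subst emeasure_density) (auto simp: mult.commute)
  finally show "emeasure (distr (M \<Otimes>\<^sub>M lborel) borel (\<lambda>(x, s). x - (n \<bullet> x - b) *\<^sub>R n + s *\<^sub>R e)) A =
    emeasure (density lborel (\<lambda>_. ennreal (1 / \<bar>n \<bullet> e\<bar>))) A" .
qed simp

lemma hyperplane_projection_measurable:
  fixes n :: "real ^ 'd"
  shows "(\<lambda>x. x - (n \<bullet> x - b) *\<^sub>R n) \<in>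
    borel_measurable (restrict_space lborel {x. b \<le> n \<bullet> x \<and> n \<bullet> x \<le> b + 1})"
  by (rule measurable_restrict_space1) measurable

text \<open>The projection lands on the hyperplane because \<open>n\<close> is a unit vector. This
  allows integrands to be compared on the hyperplane only.\<close>

lemma AE_hyperplane_measure:
  fixes n :: "real ^ 'd"
  assumes "norm n = 1"
  shows "AE x in hyperplane_measure n b. n \<bullet> x = b"
proof -
  have "n \<bullet> n = 1" using assms by (simp add: norm_eq_1)
  then show ?thesis
    unfolding hyperplane_measure_def
    by (subst AE_distr_iff) (auto simp: hyperplane_projection_measurable inner_diff_right)
qed

lemma sets_hyperplane_measure [simp, measurable_cong]: "sets (hyperplane_measure n b) = sets borel"
  and space_hyperplane_measure [simp]: "space (hyperplane_measure n b) = UNIV"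
  by (simp_all add: hyperplane_measure_def)

text \<open>Integral form of \<open>cavalieri_oblique_measure\<close>. The left side does not
  involve the hyperplane, so the lemma also converts between integrals over two hyperplanes
  transversal to the same \<open>e\<close>.\<close>

lemma cavalieri_oblique:
  fixes n e :: "real ^ 'd" and h :: "real ^ 'd \<Rightarrow> real"
  assumes n: "norm n = 1" and ne: "n \<bullet> e \<noteq> 0" and h: "integrable lborel h"
  shows "(\<integral>x. h x \<partial>lborel) =
    \<bar>n \<bullet> e\<bar> * (\<integral>y. (\<integral>s. h (y + s *\<^sub>R e) \<partial>lborel) \<partial>hyperplane_measure n b)"
proof -
  define S where "S = {x. b \<le> n \<bullet> x \<and> n \<bullet> x \<le> b + 1}"
  define M where "M = restrict_space lborel S"
  let ?\<Phi> = "\<lambda>(x, s). x - (n \<bullet> x - b) *\<^sub>R n + s *\<^sub>R e"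
  let ?D = "density lborel (\<lambda>_. ennreal (1 / \<bar>n \<bullet> e\<bar>)) :: (real ^ 'd) measure"
  have [measurable]: "h \<in> borel_measurable borel"
    using h by auto
  have "S \<in> sets lborel"
    using closed_slab[of b n] by (simp add: S_def)
  then interpret M: sigma_finite_measure M
    unfolding M_def by (intro sigma_finite_measure_restrict_space sigma_finite_lborel)
  interpret pair_sigma_finite M lborel ..
  have [measurable]: "(\<lambda>x. x) \<in> borel_measurable M"
    by (simp add: M_def measurable_restrict_space1)
  have \<Phi> [measurable]: "?\<Phi> \<in> borel_measurable (M \<Otimes>\<^sub>M lborel)"
    by measurable
  have D: "?D = distr (M \<Otimes>\<^sub>M lborel) borel ?\<Phi>"
    using cavalieri_oblique_measure[OF n ne, of b] by (simp add: M_def S_def)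
  have "integrable ?D h"
    by (subst integrable_density) (use h in auto)
  then have int: "integrable (M \<Otimes>\<^sub>M lborel) (\<lambda>z. h (?\<Phi> z))"
    unfolding D by (subst (asm) integrable_distr_eq) auto
  have "(1 / \<bar>n \<bullet> e\<bar>) * (\<integral>x. h x \<partial>lborel) = (\<integral>x. h x \<partial>?D)"
    by (subst integral_density) auto
  also have "\<dots> = (\<integral>z. h (?\<Phi> z) \<partial>(M \<Otimes>\<^sub>M lborel))"
    unfolding D by (rule integral_distr) auto
  also have "\<dots> = (\<integral>x. (\<integral>s. h (x - (n \<bullet> x - b) *\<^sub>R n + s *\<^sub>R e) \<partial>lborel) \<partial>M)"
    using integral_fst'[OF int] by simp
  also have "\<dots> = (\<integral>y. (\<integral>s. h (y + s *\<^sub>R e) \<partial>lborel) \<partial>hyperplane_measure n b)"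
    unfolding hyperplane_measure_def S_def[symmetric] M_def[symmetric]
    by (subst integral_distr) auto
  finally show ?thesis
    using ne by (simp add: field_simps)
qed

text \<open>Within the slab a point lies at distance at most 1 from its projection, so the preimage
  of \<open>F\<close> is compact, and continuous functions are integrable there.\<close>

lemma set_integrable_hyperplane_measure_compact:
  fixes n :: "real ^ 'd" and g :: "real ^ 'd \<Rightarrow> real"
  assumes n: "norm n = 1" and F: "compact F" and g: "continuous_on UNIV g"
  shows "set_integrable (hyperplane_measure n b) F g"
proof -
  define S where "S = {x. b \<le> n \<bullet> x \<and> n \<bullet> x \<le> b + 1}"
  define \<pi> where "\<pi> x = x - (n \<bullet> x - b) *\<^sub>R n" for x
  have cl: "closed S"
    using closed_slab[of b n] by (simp add: S_def)
  have cont: "continuous_on UNIV \<pi>"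
    unfolding \<pi>_def by (intro continuous_intros)
  have [measurable]: "g \<in> borel_measurable borel" "F \<in> sets borel"
    using g F by (auto intro: borel_measurable_continuous_onI borel_closed compact_imp_closed)
  obtain r where r: "\<And>x. x \<in> F \<Longrightarrow> norm x \<le> r"
    using compact_imp_bounded[OF F] unfolding bounded_iff by auto
  have "norm x \<le> r + 1" if "x \<in> S" "\<pi> x \<in> F" for x
  proof -
    have "norm x \<le> norm (\<pi> x) + norm ((n \<bullet> x - b) *\<^sub>R n)"
      using norm_triangle_ineq[of "\<pi> x" "(n \<bullet> x - b) *\<^sub>R n"] by (simp add: \<pi>_def)
    also have "\<dots> \<le> r + 1"
      using that r[of "\<pi> x"] by (auto simp: S_def n)
    finally show ?thesis .
  qed
  then have "bounded (S \<inter> \<pi> -` F)"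
    unfolding bounded_iff by auto
  moreover have "closed (S \<inter> \<pi> -` F)"
    using cl continuous_closed_preimage[OF cont closed_UNIV compact_imp_closed[OF F]] by auto
  ultimately have "compact (S \<inter> \<pi> -` F)"
    by (simp add: compact_eq_bounded_closed)
  moreover have "continuous_on (S \<inter> \<pi> -` F) (\<lambda>x. g (\<pi> x))"
    by (rule continuous_on_subset[OF continuous_on_compose2[OF g cont]]) auto
  ultimately have "integrable lborel (\<lambda>x. indicator (S \<inter> \<pi> -` F) x *\<^sub>R g (\<pi> x))"
    by (rule borel_integrable_compact)
  then have "integrable lborel (\<lambda>x. indicator S x *\<^sub>R (indicator F (\<pi> x) *\<^sub>R g (\<pi> x)))"
    by (simp add: indicator_inter_arith indicator_vimage mult.assoc)
  then have "integrable (restrict_space lborel S) (\<lambda>x. indicator F (\<pi> x) *\<^sub>R g (\<pi> x))"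
    by (subst integrable_restrict_space) (use cl in auto)
  moreover have "\<pi> \<in> borel_measurable (restrict_space lborel S)"
    using hyperplane_projection_measurable[of n b] by (simp add: S_def \<pi>_def[abs_def])
  ultimately show ?thesis
    unfolding set_integrable_def hyperplane_measure_def S_def[symmetric] \<pi>_def[symmetric]
    by (subst integrable_distr_eq) auto
qed

section \<open>The divergence theorem on the reference cell\<close>

lemma closed_ref_cell: "closed (ref_cell :: (real ^ 'd) set)"
  unfolding ref_cell_def
  by (intro closed_Collect_conj closed_Collect_all closed_Collect_le continuous_intros)

lemma compact_ref_cell: "compact (ref_cell :: (real ^ 'd) set)"
proof -
  have "norm x \<le> 1" if "x \<in> ref_cell" for x :: "real ^ 'd"
    using norm_le_l1_cart[of x] that by (simp add: ref_cell_def)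
  then have "bounded (ref_cell :: (real ^ 'd) set)"
    unfolding bounded_iff by blast
  then show ?thesis
    by (simp add: compact_eq_bounded_closed closed_ref_cell)
qed

lemma compact_ref_facet: "compact (ref_facet l :: (real ^ 'd) set)"
proof (cases l)
  case None
  have "compact (ref_cell \<inter> {x :: real ^ 'd. (\<Sum>i\<in>UNIV. x $ i) = 1})"
    by (intro compact_Int_closed compact_ref_cell closed_Collect_eq continuous_intros)
  then show ?thesis
    using None by (simp add: ref_facet_def Collect_conj_eq)
next
  case (Some i)
  have "compact (ref_cell \<inter> {x :: real ^ 'd. x $ i = 0})"
    by (intro compact_Int_closed compact_ref_cell closed_Collect_eq continuous_intros)
  then show ?thesis
    using Some by (simp add: ref_facet_def Collect_conj_eq)
qed

lemma norm_ref_normal: "norm (ref_normal l :: real ^ 'd) = 1"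
proof (cases l)
  case None
  have "norm (\<chi> i. 1 :: real ^ 'd) = sqrt (real CARD('d))"
    by (simp add: norm_vec_def L2_set_def)
  then show ?thesis
    by (simp add: None ref_normal_def)
qed (simp add: ref_normal_def)

lemma sum_UNIV_option: "(\<Sum>l\<in>UNIV. h l) = h None + (\<Sum>i\<in>UNIV. h (Some i))"
  for h :: "'a::finite option \<Rightarrow> 'b::comm_monoid_add"
  by (simp add: UNIV_option_conv sum.reindex)

text \<open>
  Integrating along the lines in direction \<open>i\<close> gives the boundary values of \<open>g\<close> as integrals over the
  facet \<open>Some i\<close>. To move the one at the far end to the facet \<open>None\<close>, integrate a function
  \<open>h\<close> that has the same integral along each of these lines, with respect to either hyperplane.
\<close>

lemma integral_ref_cell_partial_derivative:
  fixes g g' :: "real ^ 'd \<Rightarrow> real"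
  assumes g: "continuous_on UNIV g" and g': "continuous_on UNIV g'"
    and der: "\<And>x s. ((\<lambda>s. g (x + s *\<^sub>R axis i 1)) has_real_derivative g' (x + s *\<^sub>R axis i 1)) (at s)"
  shows "(LINT x:ref_cell|lborel. g' x) =
    (\<Sum>l\<in>UNIV. LINT x:ref_facet l|hyperplane_measure (ref_normal l) (ref_offset l).
      ref_normal l $ i * g x)"
proof -
  define e :: "real ^ 'd" where "e = axis i 1"
  define S where "S x = (\<Sum>j\<in>UNIV. x $ j)" for x :: "real ^ 'd"
  \<comment> \<open>Slides \<open>x\<close> along \<open>e\<close> to the hyperplane of the facet
    \<open>None\<close>; the sum \<open>S\<close> grows at rate 1 in this direction, so
    \<open>p\<close> is constant on each line.\<close>
  define p where "p x = x + (1 - S x) *\<^sub>R e" for x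
  let ?N = "ref_normal :: 'd option \<Rightarrow> real ^ 'd"
  let ?b = "ref_offset :: 'd option \<Rightarrow> real"
  let ?H = "\<lambda>l. hyperplane_measure (?N l) (?b l)"
  have e: "e $ i = 1" "\<And>j. j \<noteq> i \<Longrightarrow> e $ j = 0"
    by (simp_all add: e_def axis_def)
  have "(\<Sum>j\<in>UNIV. e $ j) = 1"
    by (simp add: e_def axis_def)
  then have Se: "S (x + s *\<^sub>R e) = S x + s" for x s
    by (simp add: S_def sum.distrib flip: sum_distrib_left)
  have Sp: "S (p x) = 1" for x
    by (simp add: p_def Se)
  have pe: "p (x + s *\<^sub>R e) = p x" for x s
    by (simp add: p_def Se algebra_simps)
  have contS: "continuous_on UNIV S"
    unfolding S_def by (intro continuous_intros)
  have contp: "continuous_on UNIV p"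
    unfolding p_def by (intro continuous_intros contS)
  have contgp: "continuous_on UNIV (\<lambda>x. g (p x))"
    by (rule continuous_on_compose2[OF g contp]) simp
  have NSe: "?N (Some i) \<bullet> e = - 1"
    by (simp add: ref_normal_def e_def inner_axis)
  have NNe: "?N None \<bullet> e = 1 / sqrt (real CARD('d))"
    by (simp add: ref_normal_def e_def inner_axis)
  have NSx: "?N (Some i) \<bullet> x = ?b (Some i) \<longleftrightarrow> x $ i = 0" for x
    by (simp add: ref_normal_def ref_offset_def inner_axis')
  have NNx: "?N None \<bullet> x = ?b None \<longleftrightarrow> S x = 1" for x
    by (simp add: ref_normal_def ref_offset_def S_def inner_vec_def field_simps flip: sum_divide_distrib)
  have AES: "AE y in ?H (Some i). y $ i = 0"
    using AE_hyperplane_measure[OF norm_ref_normal[of "Some i"], of "?b (Some i)"]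
    unfolding NSx .
  have AEN: "AE y in ?H None. S y = 1"
    using AE_hyperplane_measure[OF norm_ref_normal[of "None :: 'd option"], of "?b None"]
    unfolding NNx .
  have mem: "y + s *\<^sub>R e \<in> ref_cell \<longleftrightarrow> (\<forall>j. j \<noteq> i \<longrightarrow> 0 \<le> y $ j) \<and> 0 \<le> s \<and> s \<le> 1 - S y"
    if "y $ i = 0" for y s
  proof -
    have "(y + s *\<^sub>R e) $ j = (if j = i then s else y $ j)" for j
      using that by (simp add: e)
    then have "(\<forall>j. 0 \<le> (y + s *\<^sub>R e) $ j) \<longleftrightarrow> (\<forall>j. j \<noteq> i \<longrightarrow> 0 \<le> y $ j) \<and> 0 \<le> s"
      by (auto split: if_splits)
    moreover have "(\<Sum>j\<in>UNIV. (y + s *\<^sub>R e) $ j) = S y + s"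
      using Se by (simp add: S_def)
    ultimately show ?thesis
      by (auto simp: ref_cell_def)
  qed
  have facetS: "y \<in> ref_facet (Some i) \<longleftrightarrow> (\<forall>j. j \<noteq> i \<longrightarrow> 0 \<le> y $ j) \<and> S y \<le> 1" if "y $ i = 0" for y
    using mem[OF that, of 0] that by (auto simp: ref_facet_def)
  have facetN: "p y \<in> ref_facet None \<longleftrightarrow> y \<in> ref_facet (Some i)" if "y $ i = 0" for y
    using mem[OF that, of "1 - S y"] facetS[OF that] Sp[of y]
    by (auto simp: ref_facet_def p_def S_def)
  have [measurable]: "ref_facet l \<in> sets borel" "(ref_cell :: (real ^ 'd) set) \<in> sets borel" for l :: "'d option"
    by (auto intro: borel_closed compact_imp_closed compact_ref_facet compact_ref_cell)
  have [measurable]: "g \<in> borel_measurable borel" "g' \<in> borel_measurable borel"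
      "(\<lambda>x. g (p x)) \<in> borel_measurable borel" "p \<in> borel_measurable borel"
    using g g' contgp contp by (auto intro: borel_measurable_continuous_onI)

  have int: "set_integrable (?H l) (ref_facet l) h" if "continuous_on UNIV h"
    for h :: "real ^ 'd \<Rightarrow> real" and l
    using set_integrable_hyperplane_measure_compact[OF norm_ref_normal compact_ref_facet that] .

  \<comment> \<open>The line through \<open>y\<close> meets the cell in the segment from
    \<open>y\<close> to \<open>p y\<close>, or not at all; the fundamental theorem of calculus
    leaves the two end values.\<close>
  have fibre: "(\<integral>s. indicator ref_cell (y + s *\<^sub>R e) *\<^sub>R g' (y + s *\<^sub>R e) \<partial>lborel) =
      indicator (ref_facet (Some i)) y *\<^sub>R (g (p y) - g y)" if y: "y $ i = 0" for y
  proof (cases "y \<in> ref_facet (Some i)")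
    case True
    then have *: "\<forall>j. j \<noteq> i \<longrightarrow> 0 \<le> y $ j" "0 \<le> 1 - S y"
      using facetS[OF y] by auto
    have "(\<integral>s. indicator ref_cell (y + s *\<^sub>R e) *\<^sub>R g' (y + s *\<^sub>R e) \<partial>lborel) =
        (\<integral>s. g' (y + s *\<^sub>R e) * indicator {0..1 - S y} s \<partial>lborel)"
      by (rule Bochner_Integration.integral_cong) (use * in \<open>auto simp: indicator_def mem[OF y]\<close>)
    also have "\<dots> = g (y + (1 - S y) *\<^sub>R e) - g (y + 0 *\<^sub>R e)"
    proof (rule integral_FTC_Icc_real)
      show "((\<lambda>s. g (y + s *\<^sub>R e)) has_real_derivative g' (y + x *\<^sub>R e)) (at x)" for x
        using der by (simp add: e_def)
      have "continuous_on UNIV (\<lambda>s. g' (y + s *\<^sub>R e))"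
        by (rule continuous_on_compose2[OF g']) (auto intro!: continuous_intros)
      then show "isCont (\<lambda>s. g' (y + s *\<^sub>R e)) x" for x
        by (simp add: continuous_on_eq_continuous_at)
    qed (use * in auto)
    finally show ?thesis
      using True by (simp add: p_def)
  next
    case False
    then have "\<not> (y + s *\<^sub>R e \<in> ref_cell)" for s
      using facetS[OF y] mem[OF y] by auto
    then show ?thesis
      using False by simp
  qed
  have "(LINT x:ref_cell|lborel. g' x) =
      (\<integral>y. (\<integral>s. indicator ref_cell (y + s *\<^sub>R e) *\<^sub>R g' (y + s *\<^sub>R e) \<partial>lborel) \<partial>?H (Some i))"
    unfolding set_lebesgue_integral_def
    by (subst cavalieri_oblique[OF norm_ref_normal[of "Some i"], of e _ "?b (Some i)"])
       (use NSe borel_integrable_compact[OF compact_ref_cell continuous_on_subset[OF g']] in auto)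
  also have "\<dots> = (LINT y:ref_facet (Some i)|?H (Some i). g (p y) - g y)"
    unfolding set_lebesgue_integral_def
  proof (rule integral_cong_AE)
    show "AE y in ?H (Some i). (\<integral>s. indicator ref_cell (y + s *\<^sub>R e) *\<^sub>R g' (y + s *\<^sub>R e) \<partial>lborel) =
      indicator (ref_facet (Some i)) y *\<^sub>R (g (p y) - g y)"
      using AES by eventually_elim (rule fibre)
  qed measurable
  also have "\<dots> = (LINT y:ref_facet (Some i)|?H (Some i). g (p y)) -
      (LINT y:ref_facet (Some i)|?H (Some i). g y)"
    by (rule set_integral_diff) (intro int contgp g)+
  finally have 1: "(LINT x:ref_cell|lborel. g' x) =
    (LINT y:ref_facet (Some i)|?H (Some i). g (p y)) - (LINT y:ref_facet (Some i)|?H (Some i). g y)" .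

  \<comment> \<open>The last factor cuts each line to a piece of parameter length 1, since
    \<open>e $ i = 1\<close>. The line integral of \<open>h\<close> is then the value of
    \<open>g\<close> at the end point \<open>p x\<close>, or 0 if that point is outside the facet
    \<open>None\<close>.\<close>
  define h where "h x = indicator (ref_facet None) (p x) * g (p x) * indicator {0..1} (x $ i)" for x
  have [measurable]: "h \<in> borel_measurable borel"
    unfolding h_def by measurable
  \<comment> \<open>\<open>h\<close> vanishes outside \<open>Q\<close>, and compactness of
    \<open>Q\<close> makes it integrable: \<open>p x\<close> stays in the unit ball and the slide
    from \<open>x\<close> to \<open>p x\<close> has length at most 1.\<close>
  define Q where "Q = p -` ref_facet None \<inter> {x. 0 \<le> x $ i \<and> x $ i \<le> 1}"
  have "norm x \<le> 2" if "x \<in> Q" for x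
  proof -
    from that have q: "p x \<in> ref_cell" "0 \<le> x $ i" "x $ i \<le> 1"
      by (auto simp: Q_def ref_facet_def)
    have "norm (p x) \<le> 1"
      using norm_le_l1_cart[of "p x"] q(1) by (simp add: ref_cell_def)
    have "0 \<le> p x $ i" "p x $ i \<le> 1"
      using q(1) component_le_norm_cart[of "p x" i] \<open>norm (p x) \<le> 1\<close> by (auto simp: ref_cell_def)
    then have "\<bar>1 - S x\<bar> \<le> 1"
      using q by (simp add: p_def e)
    have "norm x = norm (p x - (1 - S x) *\<^sub>R e)"
      by (simp add: p_def)
    also have "\<dots> \<le> norm (p x) + norm ((1 - S x) *\<^sub>R e)"
      by (rule norm_triangle_ineq4)
    also have "\<dots> \<le> 2"
      using \<open>norm (p x) \<le> 1\<close> \<open>\<bar>1 - S x\<bar> \<le> 1\<close> by (simp add: e_def)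
    finally show ?thesis .
  qed
  then have "bounded Q"
    unfolding bounded_iff by blast
  moreover have "closed Q"
    unfolding Q_def
    by (intro closed_Int closed_vimage compact_imp_closed compact_ref_facet contp
        closed_Collect_conj closed_Collect_le continuous_intros)
  ultimately have "integrable lborel (\<lambda>x. indicator Q x *\<^sub>R g (p x))"
    by (intro borel_integrable_compact continuous_on_subset[OF contgp])
      (auto simp: compact_eq_bounded_closed)
  moreover have "(\<lambda>x. indicator Q x *\<^sub>R g (p x)) = h"
    by (auto simp: fun_eq_iff h_def Q_def indicator_def)
  ultimately have h: "integrable lborel h"
    by simp
  have "(\<integral>s. h (y + s *\<^sub>R e) \<partial>lborel) = indicator (ref_facet None) (p y) * g (p y)" for y
  proof -
    have "(\<integral>s. h (y + s *\<^sub>R e) \<partial>lborel) =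
        (\<integral>s. indicator (ref_facet None) (p y) * g (p y) * indicator {- y $ i..1 - y $ i} s \<partial>lborel)"
      by (rule Bochner_Integration.integral_cong) (auto simp: h_def pe e indicator_def)
    then show ?thesis
      by simp
  qed
  \<comment> \<open>The left side is the same for every transversal facet. The factor is 1 for
    \<open>Some i\<close> and \<open>1 / sqrt (real CARD('d))\<close> for \<open>None\<close>, the
    latter being the \<open>i\<close>-th component of the normal there.\<close>
  then have hfibre: "(\<integral>x. h x \<partial>lborel) =
      \<bar>?N l \<bullet> e\<bar> * (\<integral>y. indicator (ref_facet None) (p y) * g (p y) \<partial>?H l)" if "?N l \<bullet> e \<noteq> 0" for l
    using cavalieri_oblique[OF norm_ref_normal[of l] that h, of "?b l"] by simp
  have "(LINT y:ref_facet (Some i)|?H (Some i). g (p y)) =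
      (\<integral>y. indicator (ref_facet None) (p y) * g (p y) \<partial>?H (Some i))"
    unfolding set_lebesgue_integral_def
  proof (rule integral_cong_AE)
    show "AE y in ?H (Some i). indicator (ref_facet (Some i)) y *\<^sub>R g (p y) =
      indicator (ref_facet None) (p y) * g (p y)"
      using AES by eventually_elim (simp add: indicator_def facetN)
  qed measurable
  also have "\<dots> = (\<integral>x. h x \<partial>lborel)"
    using hfibre[of "Some i"] NSe by simp
  also have "\<dots> = 1 / sqrt (real CARD('d)) *
      (\<integral>y. indicator (ref_facet None) (p y) * g (p y) \<partial>?H None)"
    using hfibre[of None] NNe by simp
  also have "(\<integral>y. indicator (ref_facet None) (p y) * g (p y) \<partial>?H None) =
      (LINT y:ref_facet None|?H None. g y)"
    unfolding set_lebesgue_integral_def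
  proof (rule integral_cong_AE)
    show "AE y in ?H None. indicator (ref_facet None) (p y) * g (p y) =
      indicator (ref_facet None) y *\<^sub>R g y"
      using AEN by eventually_elim (simp add: p_def)
  qed measurable
  finally have 2: "(LINT y:ref_facet (Some i)|?H (Some i). g (p y)) =
    1 / sqrt (real CARD('d)) * (LINT y:ref_facet None|?H None. g y)" .

  have "(\<Sum>l\<in>UNIV. LINT x:ref_facet l|?H l. ?N l $ i * g x) =
      (\<Sum>l\<in>UNIV. ?N l $ i * (LINT x:ref_facet l|?H l. g x))"
    by simp
  \<comment> \<open>The normals of the facets \<open>Some j\<close> with \<open>j\<close> different
    from \<open>i\<close> have zero \<open>i\<close>-th component and contribute nothing.\<close>
  also have "\<dots> = 1 / sqrt (real CARD('d)) * (LINT y:ref_facet None|?H None. g y) +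
      (\<Sum>j\<in>UNIV. if j = i then - (LINT y:ref_facet (Some i)|?H (Some i). g y) else 0)"
    unfolding sum_UNIV_option
    by (intro arg_cong2[where f = "(+)"] sum.cong) (auto simp: ref_normal_def axis_def)
  finally show ?thesis
    using 1 2 by simp
qed

lemma set_integrable_ref_cell:
  fixes h :: "real ^ 'd \<Rightarrow> real"
  assumes "continuous_on UNIV h"
  shows "set_integrable lborel ref_cell h"
  unfolding set_integrable_def
  by (rule borel_integrable_compact[OF compact_ref_cell continuous_on_subset[OF assms]]) simp

text \<open>Product rule: for \<open>F x = M *v x + a\<close> the divergence of \<open>p F\<close>
  is \<open>F \<bullet> gradient p + trace M * p\<close>. Each component of \<open>p F\<close> goes
  through \<open>integral_ref_cell_partial_derivative\<close>, and summing over the components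
  assembles the normal component on the facets.\<close>

lemma divergence_theorem_ref_cell:
  fixes M :: "real ^ 'd ^ 'd" and p :: "real ^ 'd \<Rightarrow> real" and p' :: "real ^ 'd \<Rightarrow> real ^ 'd \<Rightarrow> real"
  assumes p': "\<And>x. (p has_derivative p' x) (at x)" and cont: "\<And>v. continuous_on UNIV (\<lambda>x. p' x v)"
  shows "inner_ref_cell (\<lambda>x. M *v x + a) (gradient p) -
      inner_ref_boundary (\<lambda>l x. (M *v x + a) \<bullet> ref_normal l) (\<lambda>l. p) =
    - trace M * (LINT x:ref_cell|lborel. p x)"
proof -
  define F where "F x = M *v x + a" for x
  have contp: "continuous_on UNIV p"
    using has_derivative_continuous[OF p'] by (simp add: continuous_on_eq_continuous_at)
  have contF: "continuous_on UNIV (\<lambda>x. F x $ i)" for i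
    unfolding F_def by (intro continuous_intros linear_continuous_on_compose matrix_vector_mul_linear)
  define g where "g i x = F x $ i * p x" for i x
  define g' where "g' i x = M $ i $ i * p x + F x $ i * p' x (axis i 1)" for i x
  have contg: "continuous_on UNIV (g i)" for i
    unfolding g_def by (intro continuous_intros contp contF)
  have contg': "continuous_on UNIV (g' i)" for i
    unfolding g'_def by (intro continuous_intros contp contF cont)
  have der: "((\<lambda>s. g i (x + s *\<^sub>R axis i 1)) has_real_derivative g' i (x + s *\<^sub>R axis i 1)) (at s)" for i x s
  proof -
    have Fs: "F (x + s *\<^sub>R axis i 1) $ i = F x $ i + s * M $ i $ i" for s
      by (simp add: F_def matrix_vector_right_distrib matrix_vector_mult_scaleR
          matrix_vector_mul_component inner_axis)
    have "((\<lambda>s. p (x + s *\<^sub>R axis i 1)) has_derivative (\<lambda>r. p' (x + s *\<^sub>R axis i 1) (r *\<^sub>R axis i 1))) (at s)"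
      by (rule has_derivative_compose[OF _ p']) (auto intro!: derivative_eq_intros)
    then have "((\<lambda>s. p (x + s *\<^sub>R axis i 1)) has_real_derivative p' (x + s *\<^sub>R axis i 1) (axis i 1)) (at s)"
      using linear_cmul[OF has_derivative_linear[OF p']]
      by (simp add: has_field_derivative_def mult_commute_abs)
    then show ?thesis
      unfolding g_def g'_def Fs by (auto intro!: derivative_eq_intros)
  qed
  have grad: "gradient p x = (\<chi> i. p' x (axis i 1))" for x
    by (simp add: gradient_def flip: frechet_derivative_at[OF p'])
  have contFgrad: "continuous_on UNIV (\<lambda>x. F x \<bullet> gradient p x)"
    unfolding grad inner_vec_def by (auto intro!: continuous_intros contF cont)
  have sum_g': "(\<Sum>i\<in>UNIV. g' i x) = F x \<bullet> gradient p x + trace M * p x" for x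
    by (simp add: g'_def grad inner_vec_def trace_def sum.distrib sum_distrib_right)
  have sum_g: "(\<Sum>i\<in>UNIV. ref_normal l $ i * g i x) = F x \<bullet> ref_normal l * p x" for l x
    by (simp add: g_def inner_vec_def sum_distrib_left mult_ac)
  have int_g: "set_integrable (hyperplane_measure (ref_normal l) b) (ref_facet l) (\<lambda>x. ref_normal l $ i * g i x)"
    for l :: "'d option" and b i
    by (intro set_integrable_hyperplane_measure_compact norm_ref_normal compact_ref_facet
        continuous_intros contg)
  have "(LINT x:ref_cell|lborel. F x \<bullet> gradient p x) + trace M * (LINT x:ref_cell|lborel. p x) =
      (LINT x:ref_cell|lborel. F x \<bullet> gradient p x + trace M * p x)"
    by (subst set_integral_add)
       (auto intro!: set_integrable_ref_cell contFgrad contp continuous_intros)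
  also have "\<dots> = (LINT x:ref_cell|lborel. \<Sum>i\<in>UNIV. g' i x)"
    by (simp add: sum_g')
  also have "\<dots> = (\<Sum>i\<in>UNIV. LINT x:ref_cell|lborel. g' i x)"
    unfolding set_lebesgue_integral_def scaleR_sum_right
    using set_integrable_ref_cell[OF contg'] by (intro Bochner_Integration.integral_sum) (simp add: set_integrable_def)
  also have "\<dots> = (\<Sum>i\<in>UNIV. \<Sum>l\<in>UNIV. LINT x:ref_facet l|hyperplane_measure (ref_normal l) (ref_offset l).
      ref_normal l $ i * g i x)"
    by (intro sum.cong refl integral_ref_cell_partial_derivative contg contg' der)
  also have "\<dots> = (\<Sum>l\<in>UNIV. \<Sum>i\<in>UNIV. LINT x:ref_facet l|hyperplane_measure (ref_normal l) (ref_offset l).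
      ref_normal l $ i * g i x)"
    by (rule sum.swap)
  also have "\<dots> = (\<Sum>l\<in>UNIV. LINT x:ref_facet l|hyperplane_measure (ref_normal l) (ref_offset l).
      (\<Sum>i\<in>UNIV. ref_normal l $ i * g i x))"
    unfolding set_lebesgue_integral_def scaleR_sum_right
    using int_g by (intro sum.cong refl Bochner_Integration.integral_sum[symmetric]) (simp add: set_integrable_def)
  finally show ?thesis
    by (simp add: sum_g inner_ref_cell_def inner_ref_boundary_def F_def)
qed

section \<open>Polynomials on the reference cell\<close>

lemma finite_multi_indices: "finite {m :: 'd::finite \<Rightarrow> nat. (\<Sum>i\<in>UNIV. m i) \<le> k}"
proof (rule finite_subset)
  show "{m :: 'd \<Rightarrow> nat. (\<Sum>i\<in>UNIV. m i) \<le> k} \<subseteq> (UNIV \<rightarrow>\<^sub>E {..k})"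
  proof clarify
    fix m :: "'d \<Rightarrow> nat" assume "(\<Sum>i\<in>UNIV. m i) \<le> k"
    moreover have "m i \<le> (\<Sum>i\<in>UNIV. m i)" for i
      by (rule member_le_sum) auto
    ultimately have "m i \<le> k" for i
      using order_trans by blast
    then show "m \<in> (UNIV \<rightarrow>\<^sub>E {..k})"
      by (simp add: PiE_iff)
  qed
qed (simp add: finite_PiE)

lemma poly_space_diff_const:
  fixes p :: "real ^ 'd \<Rightarrow> real"
  assumes "p \<in> poly_space k"
  shows "(\<lambda>x. p x - c) \<in> poly_space k"
proof -
  obtain a where a: "p = (\<lambda>\<xi>. \<Sum>m | (\<Sum>i\<in>UNIV. m i) \<le> k. a m * (\<Prod>i\<in>UNIV. (\<xi> $ i) ^ m i))"
    using assms by (auto simp: poly_space_def)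
  \<comment> \<open>Only the coefficient of the zero multi-index changes; this index is admissible
    for every \<open>k\<close>, also for \<open>k = 0\<close>.\<close>
  have "p x - c = (\<Sum>m | (\<Sum>i\<in>UNIV. m i) \<le> k.
      (a m - (if m = (\<lambda>_. 0) then c else 0)) * (\<Prod>i\<in>UNIV. (x $ i) ^ m i))" for x
  proof -
    have "(\<Sum>m | (\<Sum>i\<in>UNIV. m i) \<le> k. (if m = (\<lambda>_. 0) then c else 0) * (\<Prod>i\<in>UNIV. (x $ i) ^ m i)) =
        (\<Sum>m :: 'd \<Rightarrow> nat | (\<Sum>i\<in>UNIV. m i) \<le> k. if m = (\<lambda>_. 0) then c else 0)"
      by (intro sum.cong) auto
    also have "\<dots> = c"
      by (simp add: finite_multi_indices)
    finally show ?thesis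
      by (simp add: a left_diff_distrib sum_subtractf)
  qed
  then have "(\<lambda>x. p x - c) = (\<lambda>x. \<Sum>m | (\<Sum>i\<in>UNIV. m i) \<le> k.
      (a m - (if m = (\<lambda>_. 0) then c else 0)) * (\<Prod>i\<in>UNIV. (x $ i) ^ m i))"
    by (rule ext)
  then show ?thesis
    unfolding poly_space_def by (intro CollectI exI)
qed

lemma poly_space_derivative:
  fixes p :: "real ^ 'd \<Rightarrow> real"
  assumes "p \<in> poly_space k"
  obtains p' where "\<And>x. (p has_derivative p' x) (at x)" "\<And>v. continuous_on UNIV (\<lambda>x. p' x v)"
proof -
  obtain a where a: "p = (\<lambda>\<xi>. \<Sum>m | (\<Sum>i\<in>UNIV. m i) \<le> k. a m * (\<Prod>i\<in>UNIV. (\<xi> $ i) ^ m i))"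
    using assms by (auto simp: poly_space_def)
  \<comment> \<open>For \<open>m i = 0\<close> the truncated exponent \<open>m i - 1\<close> is 0,
    but the factor \<open>real (m i)\<close> removes the term.\<close>
  let ?p' = "\<lambda>(x :: real ^ 'd) (v :: real ^ 'd). \<Sum>m | (\<Sum>i\<in>UNIV. m i) \<le> k. a m *
    (\<Sum>i\<in>UNIV. real (m i) * v $ i * (x $ i) ^ (m i - 1) * (\<Prod>j\<in>UNIV - {i}. (x $ j) ^ m j))"
  show thesis
  proof
    fix x :: "real ^ 'd"
    have "((\<lambda>x. (x $ i) ^ j) has_derivative (\<lambda>v. real j * v $ i * (x $ i) ^ (j - 1))) (at x)" for i j
      by (intro has_derivative_power bounded_linear_imp_has_derivative bounded_linear_vec_nth)
    then show "(p has_derivative ?p' x) (at x)"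
      unfolding a
      by (intro has_derivative_sum has_derivative_mult_right has_derivative_prod)
    show "continuous_on UNIV (\<lambda>x. ?p' x v)" for v
      by (intro continuous_intros)
  qed
qed

lemma poly_space_continuous:
  fixes p :: "real ^ 'd \<Rightarrow> real"
  assumes "p \<in> poly_space k"
  shows "continuous_on UNIV p"
proof -
  obtain p' where p': "\<And>x. (p has_derivative p' x) (at x)" "\<And>v. continuous_on UNIV (\<lambda>x. p' x v)"
    by (rule poly_space_derivative[OF assms]) (rule that)
  have "isCont p x" for x
    using p'(1) by (rule has_derivative_continuous)
  then show ?thesis
    by (simp add: continuous_on_eq_continuous_at)
qed

lemma convex_ref_cell: "convex (ref_cell :: (real ^ 'd) set)"
  unfolding convex_def ref_cell_def
proof safe
  fix x y :: "real ^ 'd" and u v :: real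
  assume xy: "\<forall>i. 0 \<le> x $ i" "(\<Sum>i\<in>UNIV. x $ i) \<le> 1" "\<forall>i. 0 \<le> y $ i" "(\<Sum>i\<in>UNIV. y $ i) \<le> 1"
    and uv: "0 \<le> u" "0 \<le> v" "u + v = 1"
  show "0 \<le> (u *\<^sub>R x + v *\<^sub>R y) $ i" for i
    using xy uv by simp
  have "(\<Sum>i\<in>UNIV. (u *\<^sub>R x + v *\<^sub>R y) $ i) = u * (\<Sum>i\<in>UNIV. x $ i) + v * (\<Sum>i\<in>UNIV. y $ i)"
    by (simp add: sum.distrib sum_distrib_left)
  also have "\<dots> \<le> 1"
    using convex_bound_le[of _ 1] xy uv by blast
  finally show "(\<Sum>i\<in>UNIV. (u *\<^sub>R x + v *\<^sub>R y) $ i) \<le> 1" .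
qed

lemma interior_ref_cell_nonempty: "interior (ref_cell :: (real ^ 'd) set) \<noteq> {}"
proof -
  let ?S = "{x :: real ^ 'd. (\<forall>i. 0 < x $ i) \<and> (\<Sum>i\<in>UNIV. x $ i) < 1}"
  have "?S = (\<Inter>i. {x. 0 < x $ i}) \<inter> {x. (\<Sum>i\<in>UNIV. x $ i) < 1}"
    by auto
  also have "open \<dots>"
    by (intro open_Int open_INT ballI open_Collect_less continuous_intros) auto
  finally have "?S \<subseteq> interior ref_cell"
    by (intro interior_maximal) (auto simp: ref_cell_def less_imp_le)
  moreover have "(\<chi> i. 1 / (real CARD('d) + 1)) \<in> ?S"
    by (simp add: field_simps)
  ultimately show ?thesis by blast
qed

lemma closure_interior_ref_cell: "closure (interior ref_cell) = (ref_cell :: (real ^ 'd) set)"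
  by (simp add: convex_closure_interior convex_ref_cell interior_ref_cell_nonempty closed_ref_cell closure_closed)

lemma negligible_ref_cell_boundary: "negligible (ref_cell - interior ref_cell :: (real ^ 'd) set)"
  using negligible_convex_frontier[OF convex_ref_cell]
  by (simp add: frontier_def closed_ref_cell closure_closed)

text \<open>The set where \<open>q\<close> does not vanish meets the interior in an open null set,
  hence not at all. Density of the interior in the cell carries this to the boundary points, where
  traces are evaluated.\<close>

lemma ref_cell_square_integral_zero:
  fixes q :: "real ^ 'd \<Rightarrow> real"
  assumes q: "continuous_on UNIV q" and 0: "(LINT x:ref_cell|lborel. q x * q x) = 0" and x: "x \<in> ref_cell"
  shows "q x = 0"
proof -
  have cont: "continuous_on UNIV (\<lambda>x. q x * q x)"
    by (intro continuous_intros q)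
  have "AE y in lborel. indicator ref_cell y *\<^sub>R (q y * q y) = 0"
    using 0 set_integrable_ref_cell[OF cont]
    by (subst integral_nonneg_eq_0_iff_AE[symmetric])
       (auto simp: set_lebesgue_integral_def set_integrable_def)
  then have "AE y in lborel. y \<in> ref_cell \<longrightarrow> q y = 0"
    by eventually_elim (auto simp: indicator_def)
  then obtain Z where Z: "Z \<in> null_sets lborel" "{y. \<not> (y \<in> ref_cell \<longrightarrow> q y = 0)} \<subseteq> Z"
    unfolding eventually_ae_filter by auto
  have op: "open (interior ref_cell \<inter> {y. q y \<noteq> 0})"
    by (intro open_Int open_interior open_Collect_neq q continuous_intros)
  moreover have "negligible (interior ref_cell \<inter> {y. q y \<noteq> 0})"
  proof (rule negligible_subset)
    show "negligible Z"
      using Z(1) by (simp add: negligible_iff_null_sets null_sets_completionI)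
    show "interior ref_cell \<inter> {y. q y \<noteq> 0} \<subseteq> Z"
      using Z(2) interior_subset by blast
  qed
  ultimately have "interior ref_cell \<inter> {y. q y \<noteq> 0} = {}"
    using open_not_negligible by blast
  then have "interior ref_cell \<subseteq> {y. q y = 0}"
    by blast
  then have "closure (interior ref_cell) \<subseteq> {y. q y = 0}"
    by (intro closure_minimal closed_Collect_eq q continuous_intros)
  then show ?thesis
    using x by (auto simp: closure_interior_ref_cell)
qed

section \<open>Simplices and test functions\<close>

text \<open>Treats the base vertex and the other vertices alike: the cell is where all coordinates
  are nonnegative, and the facet opposite to \<open>l\<close> is where the \<open>l\<close>-th one
  vanishes as well.\<close>

definition barycentric :: "real ^ 'd \<Rightarrow> 'd option \<Rightarrow> real" where
  "barycentric \<xi> l = (case l of None \<Rightarrow> 1 - (\<Sum>i\<in>UNIV. \<xi> $ i) | Some i \<Rightarrow> \<xi> $ i)"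

lemma ref_map_barycentric: "ref_map w \<xi> = (\<Sum>l\<in>UNIV. barycentric \<xi> l *\<^sub>R w l)"
proof -
  have "edge_matrix w *v \<xi> = (\<Sum>i\<in>UNIV. \<xi> $ i *\<^sub>R (w (Some i) - w None))"
    by (simp add: vec_eq_iff matrix_vector_mult_def edge_matrix_def mult.commute)
  then show ?thesis
    by (simp add: ref_map_def sum_UNIV_option barycentric_def scaleR_diff_left scaleR_diff_right
        sum_subtractf scaleR_sum_left)
qed

lemma sum_barycentric: "(\<Sum>l\<in>UNIV. barycentric \<xi> l) = 1"
  by (simp add: sum_UNIV_option barycentric_def)

lemma ref_cell_barycentric: "\<xi> \<in> ref_cell \<longleftrightarrow> (\<forall>l. 0 \<le> barycentric \<xi> l)"
  by (auto simp: ref_cell_def barycentric_def split: option.split)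

lemma ref_facet_barycentric: "\<xi> \<in> ref_facet l \<longleftrightarrow> \<xi> \<in> ref_cell \<and> barycentric \<xi> l = 0"
  by (auto simp: ref_facet_def barycentric_def split: option.split)

text \<open>On the facet the weight of the opposite vertex is zero, which leaves a convex
  combination of the remaining vertices.\<close>

lemma ref_map_facet_in_hull:
  assumes "\<xi> \<in> ref_facet l"
  shows "ref_map w \<xi> \<in> convex hull (w ` (UNIV - {l}))"
proof -
  have b: "barycentric \<xi> l = 0" "\<And>l. 0 \<le> barycentric \<xi> l"
    using assms by (auto simp: ref_facet_barycentric ref_cell_barycentric)
  have "(\<Sum>j\<in>UNIV - {l}. barycentric \<xi> j) = 1"
    using sum_barycentric[of \<xi>] b(1) by (simp add: sum.remove[of UNIV l])
  moreover have "ref_map w \<xi> = (\<Sum>j\<in>UNIV - {l}. barycentric \<xi> j *\<^sub>R w j)"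
    using b(1) by (simp add: ref_map_barycentric sum.remove[of UNIV l])
  ultimately show ?thesis
    using b(2) by (simp, intro convex_sum) (auto intro: hull_inc)
qed

lemma ref_map_ref_cell: "ref_map w ` ref_cell = convex hull (range w)"
proof
  show "ref_map w ` ref_cell \<subseteq> convex hull (range w)"
    using sum_barycentric by (auto simp: ref_map_barycentric ref_cell_barycentric hull_inc intro!: convex_sum)
  have "convex (ref_map w ` ref_cell)"
    using convex_translation[OF convex_linear_image[OF matrix_vector_mul_linear convex_ref_cell],
        of "w None" "edge_matrix w"]
    by (simp add: ref_map_def image_image add.commute)
  moreover have "w l \<in> ref_map w ` ref_cell" for l
  proof (cases l)
    case None
    have "w l = ref_map w 0" "0 \<in> ref_cell"
      by (auto simp: None ref_map_def ref_cell_def)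
    then show ?thesis by blast
  next
    case (Some i)
    have "w l = ref_map w (axis i 1)"
      by (simp add: Some ref_map_def matrix_vector_mul_component vec_eq_iff edge_matrix_def
          inner_axis)
    moreover have "axis i 1 \<in> ref_cell"
      by (auto simp: ref_cell_def axis_def)
    ultimately show ?thesis by blast
  qed
  ultimately show "convex hull (range w) \<subseteq> ref_map w ` ref_cell"
    by (intro hull_minimal) auto
qed

lemma matrix_inv_cancel:
  fixes A :: "real ^ 'd ^ 'd"
  assumes "det A \<noteq> 0"
  shows "matrix_inv A *v (A *v x) = x" and "A *v (matrix_inv A *v x) = x"
proof -
  have "invertible A"
    using assms by (simp add: invertible_det_nz)
  then have "A ** matrix_inv A = mat 1 \<and> matrix_inv A ** A = mat 1"
    unfolding invertible_def matrix_inv_def by (rule someI_ex)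
  then show "matrix_inv A *v (A *v x) = x" "A *v (matrix_inv A *v x) = x"
    by (simp_all add: matrix_vector_mul_assoc)
qed

lemma matrix_inv_ref_map:
  assumes "det (edge_matrix w) \<noteq> 0"
  shows "matrix_inv (edge_matrix w) *v (ref_map w \<xi> - w None) = \<xi>"
  using assms by (simp add: ref_map_def matrix_inv_cancel)

text \<open>Guarantees that the exterior trace reads the neighbouring function inside its reference
  cell, the only place where it is known to be constant. The reason is that the facet lies in the
  hull of vertices belonging to \<open>w'\<close> too.\<close>

lemma ref_map_facet_pull_back:
  assumes "w ` (UNIV - {l}) \<subseteq> range w'" "det (edge_matrix w') \<noteq> 0" "\<xi> \<in> ref_facet l"
  shows "matrix_inv (edge_matrix w') *v (ref_map w \<xi> - w' None) \<in> ref_cell"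
proof -
  have "ref_map w \<xi> \<in> convex hull (range w')"
    using ref_map_facet_in_hull[OF assms(3)] hull_mono[OF assms(1)] by blast
  then obtain \<eta> where "\<eta> \<in> ref_cell" "ref_map w \<xi> = ref_map w' \<eta>"
    unfolding ref_map_ref_cell[symmetric] by auto
  then show ?thesis
    by (simp add: matrix_inv_ref_map assms(2))
qed

text \<open>The affine map is open for an invertible edge matrix, so it sends the interior to an
  open part of the convex hull.\<close>

lemma ref_map_interior_in_cell:
  assumes "det (edge_matrix w) \<noteq> 0" "\<xi> \<in> interior ref_cell"
  shows "ref_map w \<xi> \<in> cell w"
proof -
  have "surj ((*v) (edge_matrix w))"
    using matrix_inv_cancel(2)[OF assms(1)] by (metis surjI)
  then have "open ((*v) (edge_matrix w) ` interior ref_cell)"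
    by (intro open_surjective_linear_image matrix_vector_mul_linear) auto
  then have "open (ref_map w ` interior ref_cell)"
    using open_translation[of "(*v) (edge_matrix w) ` interior ref_cell" "w None"]
    by (simp add: image_image ref_map_def add.commute)
  moreover have "ref_map w ` interior ref_cell \<subseteq> convex hull (range w)"
    using ref_map_ref_cell[of w] interior_subset by blast
  ultimately have "ref_map w ` interior ref_cell \<subseteq> cell w"
    unfolding cell_def by (intro interior_maximal)
  then show ?thesis
    using assms(2) by blast
qed

lemma AE_ref_map_in_cell:
  fixes w :: "'d option \<Rightarrow> real ^ 'd"
  assumes "det (edge_matrix w) \<noteq> 0"
  shows "AE \<xi> in lebesgue_on ref_cell. ref_map w \<xi> \<in> cell w"
proof -
  have "ref_cell - interior ref_cell \<in> null_sets (lebesgue :: (real ^ 'd) measure)"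
    using negligible_ref_cell_boundary by (simp add: negligible_iff_null_sets)
  then have "AE \<xi> in lebesgue. \<xi> \<notin> ref_cell - interior (ref_cell :: (real ^ 'd) set)"
    by (rule AE_not_in)
  then have "AE \<xi> in lebesgue. \<xi> \<in> ref_cell \<longrightarrow> ref_map w \<xi> \<in> cell w"
    by eventually_elim (auto intro: ref_map_interior_in_cell[OF assms])
  then show ?thesis
    by (subst AE_restrict_space_iff) (auto simp: closed_ref_cell)
qed

text \<open>The scheme is tested with functions on the whole domain, so each polynomial on one cell
  has to be realised globally. Extension by zero works because the open cells are disjoint; the
  frontier of the reference cell is a null set, which \<open>pulls_back_to\<close> ignores.\<close>

lemma dg_test_function:
  fixes x :: "'v \<Rightarrow> real ^ 'd" and conn :: "'c \<Rightarrow> 'd option \<Rightarrow> 'v"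
  assumes mesh: "simplicial_mesh \<Omega> C conn x" and \<Omega>: "open \<Omega>" and K: "K \<in> C" and p: "p \<in> poly_space k"
  obtains v where "v \<in> dg_space k \<Omega> C (\<lambda>K. x \<circ> conn K)" "pulls_back_to (x \<circ> conn K) v p"
proof
  define w where "w = x \<circ> conn K"
  define v where "v y = indicator (cell w) y * p (matrix_inv (edge_matrix w) *v (y - w None))" for y
  have det: "det (edge_matrix (x \<circ> conn K')) \<noteq> 0" if "K' \<in> C" for K'
    using mesh that by (auto simp: simplicial_mesh_def)
  have disj: "cell (x \<circ> conn K') \<inter> cell w = {}" if "K' \<in> C" "K' \<noteq> K" for K'
    using mesh that K by (auto simp: simplicial_mesh_def w_def)
  have pull_eq: "AE \<xi> in lebesgue_on ref_cell. v (ref_map (x \<circ> conn K') \<xi>) = (if K' = K then p \<xi> else 0)"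
    if "K' \<in> C" for K'
    using AE_ref_map_in_cell[OF det[OF that]]
  proof eventually_elim
    case (elim \<xi>)
    then show ?case
      using disj[OF that] matrix_inv_ref_map[OF det[OF K], of \<xi>] by (auto simp: v_def w_def indicator_def)
  qed
  then show "pulls_back_to (x \<circ> conn K) v p"
    using pull_eq[OF K] by (simp add: pulls_back_to_def)
  have "(\<lambda>_ :: real ^ 'd. 0) \<in> poly_space k"
    unfolding poly_space_def by (rule CollectI, rule exI[of _ "\<lambda>_. 0"]) simp
  then have pull: "\<exists>p\<in>poly_space k. pulls_back_to (x \<circ> conn K') v p" if "K' \<in> C" for K'
  proof (cases "K' = K")
    case True
    then show ?thesis
      using pull_eq[OF that] p by (intro bexI[of _ p]) (simp_all add: pulls_back_to_def)
  next
    case False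
    then show ?thesis
      using pull_eq[OF that] \<open>(\<lambda>_. 0) \<in> poly_space k\<close>
      by (intro bexI[of _ "\<lambda>_. 0"]) (simp_all add: pulls_back_to_def)
  qed
  let ?q = "\<lambda>y. p (matrix_inv (edge_matrix w) *v (y - w None))"
  have cont: "continuous_on UNIV ?q"
  proof (rule continuous_on_compose2[OF poly_space_continuous[OF p]])
    show "continuous_on UNIV (\<lambda>y. matrix_inv (edge_matrix w) *v (y - w None))"
      by (rule linear_continuous_on_compose[OF _ matrix_vector_mul_linear]) (intro continuous_intros)
  qed simp
  have op: "open (cell w)"
    by (simp add: cell_def)
  have "(\<lambda>y. indicator (cell w) y * ?q y) \<in> borel_measurable borel"
    by (intro borel_measurable_times borel_measurable_indicator borel_open op
        borel_measurable_continuous_onI cont)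
  then have meas: "v \<in> borel_measurable borel"
    by (simp add: v_def[abs_def])
  have "v \<in> borel_measurable (lebesgue_on \<Omega>)"
    using meas by (intro measurable_restrict_space1 measurable_completion) simp
  moreover have "integrable (lebesgue_on \<Omega>) (\<lambda>y. (v y)\<^sup>2)"
  proof -
    have comp: "compact (convex hull (range w))"
      by (intro compact_convex_hull finite_imp_compact) simp
    have "set_integrable lborel (convex hull (range w)) (\<lambda>y. (?q y)\<^sup>2)"
      unfolding set_integrable_def
      by (intro borel_integrable_compact comp continuous_on_subset[OF continuous_on_power[OF cont]]) simp
    then have "set_integrable lborel (cell w) (\<lambda>y. (?q y)\<^sup>2)"
      by (rule set_integrable_subset) (use op interior_subset in \<open>auto simp: cell_def\<close>)
    moreover have "indicator (cell w) y *\<^sub>R (?q y)\<^sup>2 = (v y)\<^sup>2" for y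
      by (auto simp: v_def indicator_def)
    ultimately have "integrable lebesgue (\<lambda>y. (v y)\<^sup>2)"
      by (simp add: set_integrable_def integrable_completion)
    moreover have \<Omega>': "\<Omega> \<in> sets lebesgue"
      using \<Omega> by simp
    ultimately have "integrable lebesgue (\<lambda>y. indicator \<Omega> y *\<^sub>R (v y)\<^sup>2)"
      by (intro integrable_mult_indicator)
    then show ?thesis
      using \<Omega>' by (simp add: integrable_restrict_space)
  qed
  ultimately show "v \<in> dg_space k \<Omega> C (\<lambda>K. x \<circ> conn K)"
    using pull by (simp add: dg_space_def)
qed

section \<open>The scheme applied to constants\<close>

text \<open>Each vertex moves at constant velocity and the barycentric weights do not depend on
  time, so the grid velocity interpolates the vertex velocities and is affine in \<xi>.\<close>

lemma grid_velocity_slab: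
  "grid_velocity (slab_vertices tm conn X n) t K \<xi> =
    ref_map (\<lambda>l. (1 / (tm (Suc n) - tm n)) *\<^sub>R (X (Suc n) (conn K l) - X n (conn K l))) \<xi>"
  unfolding grid_velocity_def ref_map_barycentric slab_vertices_def
  by (rule vector_derivative_at)
     (auto intro!: derivative_eq_intros simp: divide_inverse)

lemma divergence_affine:
  fixes M :: "real ^ 'd ^ 'd"
  shows "divergence (\<lambda>x. M *v x + a) \<xi> = trace M"
proof -
  have "((\<lambda>x. M *v x + a) has_derivative (*v) M) (at \<xi>)"
    by (intro has_derivative_add_const linear_imp_has_derivative matrix_vector_mul_linear)
  then have "frechet_derivative (\<lambda>x. M *v x + a) (at \<xi>) = (*v) M"
    by (rule frechet_derivative_at[symmetric])
  then show ?thesis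
    by (simp add: divergence_def trace_def matrix_vector_mul_component inner_axis)
qed

text \<open>Transposition moves \<open>matrix_inv A\<close> from the normal to the flux. Consistency
  applies since the transformed normal is nonzero: its inner product with \<open>A *v n\<close> is
  \<open>n \<bullet> n\<close>.\<close>

lemma numerical_flux_transformed_normal:
  fixes A :: "real ^ 'd ^ 'd"
  assumes flux: "numerical_flux f ghat" and A: "det A \<noteq> 0" and J: "J \<noteq> 0" and n: "n \<noteq> 0"
  shows "ghat \<omega> c c (J *\<^sub>R (transpose (matrix_inv A) *v n)) =
    (J *\<^sub>R (matrix_inv A *v ale_flux f \<omega> c)) \<bullet> n"
proof -
  have adj: "y \<bullet> (transpose (matrix_inv A) *v n) = (matrix_inv A *v y) \<bullet> n" for y
    by (metis transpose_matrix_vector dot_lmul_matrix inner_commute)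
  have "transpose (matrix_inv A) *v n \<noteq> 0"
  proof
    assume "transpose (matrix_inv A) *v n = 0"
    then have "(matrix_inv A *v (A *v n)) \<bullet> n = 0"
      unfolding adj[symmetric] by simp
    then show False
      using n by (simp add: matrix_inv_cancel[OF A])
  qed
  then have "ghat \<omega> c c (J *\<^sub>R (transpose (matrix_inv A) *v n)) =
      ale_flux f \<omega> c \<bullet> (J *\<^sub>R (transpose (matrix_inv A) *v n))"
    using flux J unfolding numerical_flux_def by simp
  then show ?thesis
    by (simp only: inner_scaleR_right inner_scaleR_left adj)
qed

text \<open>The point 0 merely names the constant value of the divergence, which is
  \<open>trace G\<close> in the proof. Nonzero determinants are assumed on all cells because the
  exterior trace inverts the edge matrix of the neighbour.\<close>

lemma dg_form_const:
  fixes X :: "nat \<Rightarrow> 'v \<Rightarrow> real ^ 'd" and conn :: "'c \<Rightarrow> 'd option \<Rightarrow> 'v"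
    and tm :: "nat \<Rightarrow> real" and n :: nat
  defines "P \<equiv> slab_vertices tm conn X n"
  assumes flux: "numerical_flux f ghat"
    and boundary: "boundary_preserves_const B C conn I c" and t: "t \<in> I"
    and det: "\<And>K. K \<in> C \<Longrightarrow> det (edge_matrix (P t K)) \<noteq> 0"
    and J: "J \<noteq> 0" and K: "K \<in> C" and p: "p \<in> poly_space k"
    and u: "\<And>K \<xi>. K \<in> C \<Longrightarrow> \<xi> \<in> ref_cell \<Longrightarrow> u K \<xi> = c"
  shows "dg_form f ghat B C conn P K u p J t =
    c * (divergence (\<lambda>\<eta>. matrix_inv (edge_matrix (P t K)) *v grid_velocity P t K \<eta>) 0 * J) *
      (LINT \<xi>:ref_cell|lborel. p \<xi>)"
proof -
  define A where "A = edge_matrix (P t K)"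
  define V where "V l = (1 / (tm (Suc n) - tm n)) *\<^sub>R (X (Suc n) (conn K l) - X n (conn K l))" for l
  define G where "G = matrix_inv A ** edge_matrix V"
  \<comment> \<open>The sign comes from the part \<open>- u *\<^sub>R \<omega>\<close> of the ALE
    flux; \<open>trace G\<close> is the divergence that the metric recursion uses.\<close>
  define M where "M = (- c * J) *\<^sub>R G"
  define a where "a = J *\<^sub>R (matrix_inv A *v (f c - c *\<^sub>R V None))"
  have \<omega>: "grid_velocity P t K \<xi> = edge_matrix V *v \<xi> + V None" for \<xi>
    by (simp add: P_def grid_velocity_slab V_def[abs_def] ref_map_def)
  have F: "J *\<^sub>R (matrix_inv A *v ale_flux f (grid_velocity P t K \<xi>) c) = M *v \<xi> + a" for \<xi>
  proof -
    have "M *v \<xi> = (- c * J) *\<^sub>R (matrix_inv A *v (edge_matrix V *v \<xi>))"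
      by (simp only: M_def G_def scaleR_matrix_vector_assoc[symmetric] matrix_vector_mul_assoc)
    then show ?thesis
      by (simp add: \<omega> ale_flux_def a_def matrix_vector_right_distrib matrix_vector_mult_diff_distrib
          matrix_vector_mult_scaleR scaleR_add_right scaleR_diff_right)
  qed
  have "matrix_inv A *v grid_velocity P t K \<eta> = G *v \<eta> + matrix_inv A *v V None" for \<eta>
    by (simp add: \<omega> G_def matrix_vector_right_distrib matrix_vector_mul_assoc)
  then have div: "divergence (\<lambda>\<eta>. matrix_inv A *v grid_velocity P t K \<eta>) 0 = trace G"
    by (simp add: divergence_affine)
  have trM: "trace M = - c * J * trace G"
    by (simp add: M_def trace_def sum_distrib_left)
  have ext: "exterior_trace B C conn P t u K l \<xi> = c" if \<xi>: "\<xi> \<in> ref_facet l" for l \<xi>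
  proof (cases "boundary_facet C conn K l")
    case True
    have "B t u K l \<xi> = c"
      using boundary t u K True \<xi> unfolding boundary_preserves_const_def by blast
    then show ?thesis
      by (simp add: exterior_trace_def True)
  next
    case False
    \<comment> \<open>Whichever neighbour the choice returns will do, as \<open>u\<close> equals
      \<open>c\<close> on every cell.\<close>
    define K' where "K' = (SOME K'. neighbour C conn K l K')"
    have "\<exists>K'. neighbour C conn K l K'"
      using False by (simp add: boundary_facet_def)
    then have "neighbour C conn K l K'"
      unfolding K'_def by (rule someI_ex)
    then have K': "K' \<in> C" "conn K ` (UNIV - {l}) \<subseteq> range (conn K')"
      by (auto simp: neighbour_def)
    \<comment> \<open>Positions depend on the global vertex label only, so shared labels give shared
      positions at time \<open>t\<close>.\<close>
    define pos where "pos z = X n z + ((t - tm n) / (tm (Suc n) - tm n)) *\<^sub>R (X (Suc n) z - X n z)" for z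
    have pos: "P t K = pos \<circ> conn K" for K
      by (simp add: P_def slab_vertices_def pos_def fun_eq_iff)
    have "P t K ` (UNIV - {l}) \<subseteq> range (P t K')"
      using image_mono[OF K'(2), of pos] by (simp add: pos image_comp)
    then have "u K' (matrix_inv (edge_matrix (P t K')) *v (ref_map (P t K) \<xi> - P t K' None)) = c"
      by (intro u[OF K'(1)] ref_map_facet_pull_back[OF _ det[OF K'(1)] \<xi>])
    then show ?thesis
      by (simp add: exterior_trace_def False Let_def K'_def)
  qed
  have [measurable]: "ref_facet l \<in> sets borel" "(ref_cell :: (real ^ 'd) set) \<in> sets borel" for l :: "'d option"
    by (auto intro: borel_closed compact_imp_closed compact_ref_facet compact_ref_cell)
  have volume: "inner_ref_cell (\<lambda>\<xi>. J *\<^sub>R (matrix_inv A *v ale_flux f (grid_velocity P t K \<xi>) (u K \<xi>))) (gradient p) =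
      inner_ref_cell (\<lambda>\<xi>. M *v \<xi> + a) (gradient p)"
    unfolding inner_ref_cell_def
    by (rule set_lebesgue_integral_cong) (simp_all add: closed_ref_cell u[OF K] F)
  have surface: "inner_ref_boundary
       (\<lambda>l \<xi>. ghat (grid_velocity P t K \<xi>) (u K \<xi>) (exterior_trace B C conn P t u K l \<xi>)
                (J *\<^sub>R (transpose (matrix_inv A) *v ref_normal l))) (\<lambda>l. p) =
      inner_ref_boundary (\<lambda>l \<xi>. (M *v \<xi> + a) \<bullet> ref_normal l) (\<lambda>l. p)"
    unfolding inner_ref_boundary_def
  proof (rule sum.cong[OF refl], rule set_lebesgue_integral_cong)
    fix l :: "'d option"
    have "ref_normal l \<noteq> 0"
      using norm_ref_normal[of l] by auto
    then have gh: "ghat \<omega> c c (J *\<^sub>R (transpose (matrix_inv A) *v ref_normal l)) =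
        (J *\<^sub>R (matrix_inv A *v ale_flux f \<omega> c)) \<bullet> ref_normal l" for \<omega>
      using numerical_flux_transformed_normal[OF flux _ J] det[OF K] by (simp add: A_def)
    show "\<forall>\<xi>. \<xi> \<in> ref_facet l \<longrightarrow>
        ghat (grid_velocity P t K \<xi>) (u K \<xi>) (exterior_trace B C conn P t u K l \<xi>)
          (J *\<^sub>R (transpose (matrix_inv A) *v ref_normal l)) * p \<xi> =
        (M *v \<xi> + a) \<bullet> ref_normal l * p \<xi>"
    proof (intro allI impI)
      fix \<xi> :: "real ^ 'd" assume \<xi>: "\<xi> \<in> ref_facet l"
      then have "u K \<xi> = c"
        by (intro u[OF K]) (simp add: ref_facet_barycentric)
      then show "ghat (grid_velocity P t K \<xi>) (u K \<xi>) (exterior_trace B C conn P t u K l \<xi>)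
          (J *\<^sub>R (transpose (matrix_inv A) *v ref_normal l)) * p \<xi> =
        (M *v \<xi> + a) \<bullet> ref_normal l * p \<xi>"
        by (simp only: ext[OF \<xi>] gh F)
    qed
  qed simp
  obtain p' where p': "\<And>x. (p has_derivative p' x) (at x)" "\<And>v. continuous_on UNIV (\<lambda>x. p' x v)"
    by (rule poly_space_derivative[OF p]) (rule that)
  have "dg_form f ghat B C conn P K u p J t =
      inner_ref_cell (\<lambda>\<xi>. M *v \<xi> + a) (gradient p) -
      inner_ref_boundary (\<lambda>l \<xi>. (M *v \<xi> + a) \<bullet> ref_normal l) (\<lambda>l. p)"
    unfolding dg_form_def A_def[symmetric] volume surface ..
  also have "\<dots> = - trace M * (LINT \<xi>:ref_cell|lborel. p \<xi>)"
    by (rule divergence_theorem_ref_cell[OF p'])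
  finally show ?thesis
    unfolding A_def[symmetric] div trM by simp
qed

lemma poly_space_eq_const_by_testing:
  fixes q :: "real ^ 'd \<Rightarrow> real"
  assumes J: "J \<noteq> 0" and q: "q \<in> poly_space k"
    and test: "\<And>p. p \<in> poly_space k \<Longrightarrow>
      inner_ref_cell (\<lambda>\<xi>. J * q \<xi>) p = J * c * (LINT \<xi>:ref_cell|lborel. p \<xi>)"
    and \<xi>: "\<xi> \<in> ref_cell"
  shows "q \<xi> = c"
proof -
  let ?r = "\<lambda>\<xi>. q \<xi> - c"
  note cont = poly_space_continuous[OF q]
  have "J * (LINT \<xi>:ref_cell|lborel. ?r \<xi> * ?r \<xi>) = (LINT \<xi>:ref_cell|lborel. J * (?r \<xi> * ?r \<xi>))"
    by (simp only: set_integral_mult_right)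
  also have "\<dots> = (LINT \<xi>:ref_cell|lborel. J * q \<xi> * ?r \<xi> - J * c * ?r \<xi>)"
    by (simp add: algebra_simps)
  also have "\<dots> = (LINT \<xi>:ref_cell|lborel. J * q \<xi> * ?r \<xi>) - (LINT \<xi>:ref_cell|lborel. J * c * ?r \<xi>)"
    by (rule set_integral_diff(2); intro set_integrable_ref_cell continuous_intros cont)
  also have "\<dots> = 0"
    using test[OF poly_space_diff_const[OF q, of c]]
    by (simp only: inner_ref_cell_def inner_real_def set_integral_mult_right)
  finally have "(LINT \<xi>:ref_cell|lborel. ?r \<xi> * ?r \<xi>) = 0"
    using J by simp
  then have "?r \<xi> = 0"
    by (rule ref_cell_square_integral_zero[OF continuous_on_diff[OF cont continuous_on_const] _ \<xi>])
  then show ?thesis by simp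
qed

lemma inner_ref_cell_const:
  fixes q :: "real ^ 'd \<Rightarrow> real"
  assumes "\<And>\<xi>. \<xi> \<in> ref_cell \<Longrightarrow> q \<xi> = c"
  shows "inner_ref_cell (\<lambda>\<xi>. J * q \<xi>) p = J * c * (LINT \<xi>:ref_cell|lborel. p \<xi>)"
proof -
  have "(LINT \<xi>:ref_cell|lborel. J * q \<xi> * p \<xi>) = (LINT \<xi>:ref_cell|lborel. (J * c) * p \<xi>)"
    by (rule set_lebesgue_integral_cong) (auto simp: assms closed_ref_cell)
  then show ?thesis
    by (simp only: inner_ref_cell_def inner_real_def set_integral_mult_right)
qed

theorem theorem4p3:
  fixes \<Omega> :: "(real ^ 'd) set"
    and C :: "'c set"
    and conn :: "'c \<Rightarrow> 'd option \<Rightarrow> 'v"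
    and X :: "nat \<Rightarrow> 'v \<Rightarrow> real ^ 'd"
    and T \<kappa> \<tau> c :: real
    and tm \<gamma> :: "nat \<Rightarrow> real"
    and N n s k :: nat
    and \<alpha> \<beta> :: "nat \<Rightarrow> nat \<Rightarrow> real"
    and f :: "real \<Rightarrow> real ^ 'd"
    and ghat :: "real ^ 'd \<Rightarrow> real \<Rightarrow> real \<Rightarrow> real ^ 'd \<Rightarrow> real"
    and B :: "real \<Rightarrow> ('c \<Rightarrow> real ^ 'd \<Rightarrow> real) \<Rightarrow> 'c \<Rightarrow> 'd option \<Rightarrow> real ^ 'd \<Rightarrow> real"
    and J :: "nat \<Rightarrow> 'c \<Rightarrow> real"
    and un un1 :: "'c \<Rightarrow> real ^ 'd \<Rightarrow> real"
    and u :: "nat \<Rightarrow> 'c \<Rightarrow> real ^ 'd \<Rightarrow> real"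
  defines "P \<equiv> slab_vertices tm conn X n"
    and "dt \<equiv> tm (Suc n) - tm n"
  assumes mesh: "moving_mesh \<Omega> T N tm C conn X \<kappa> \<tau>"
    and slab: "n < N"
    and flux: "numerical_flux f ghat"
    and boundary: "boundary_preserves_const B C conn {tm n..tm (Suc n)} c"
    and tvd: "tvd_runge_kutta s \<alpha> \<beta> \<gamma>"
    and order: "rk_order_at_least s \<alpha> \<beta> \<gamma> CARD('d)"
    and metric: "stage_metric_terms s \<alpha> \<beta> \<gamma> dt (tm n) C P J"
    and metric_nonzero: "\<forall>i\<in>{1..s}. \<forall>K\<in>C. J i K \<noteq> 0"
    and scheme: "ale_dg_step s \<alpha> \<beta> \<gamma> dt (tm n) k \<Omega> f ghat B C conn P J un u un1"
    and init: "\<forall>K\<in>C. \<forall>\<xi>\<in>ref_cell. un K \<xi> = c"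
  shows "\<forall>i\<le>s. \<forall>K\<in>C. \<forall>\<xi>\<in>ref_cell. u i K \<xi> = c"
proof -
  have mesh_n: "open \<Omega>" "simplicial_mesh \<Omega> C conn (X n)" and dt: "0 < dt"
    and det: "\<And>t K. t \<in> {tm n..tm (Suc n)} \<Longrightarrow> K \<in> C \<Longrightarrow> 0 < det (edge_matrix (P t K))"
    using mesh slab by (auto simp: moving_mesh_def P_def dt_def)
  have P_n: "P (tm n) = (\<lambda>K. X n \<circ> conn K)"
    by (simp add: P_def slab_vertices_def fun_eq_iff)
  have n_in: "tm n \<in> {tm n..tm n + dt}" "tm n \<in> {tm n..tm (Suc n)}"
    using dt by (auto simp: dt_def)
  have J0: "J 0 K = det (edge_matrix (P (tm n) K))" if "K \<in> C" for K
    using metric that by (simp add: stage_metric_terms_def)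
  have J_nonzero: "J i K \<noteq> 0" if "i \<le> s" "K \<in> C" for i K
  proof (cases "i = 0")
    case True
    then show ?thesis
      using J0[OF that(2)] det[OF n_in(2) that(2)] by simp
  next
    case False
    then show ?thesis
      using metric_nonzero that by simp
  qed
  have stage_time: "tm n + \<gamma> j * dt \<in> {tm n..tm (Suc n)}" if "j < s" for j
  proof -
    have "0 \<le> \<gamma> j" "\<gamma> j \<le> 1"
      using tvd that by (auto simp: tvd_runge_kutta_def)
    then have "0 \<le> \<gamma> j * dt" "\<gamma> j * dt \<le> dt"
      using dt by (simp_all add: mult_left_le_one_le)
    then show ?thesis
      by (simp add: dt_def)
  qed
  \<comment> \<open>The recursion is assumed at every point of the reference cell; it is read at 0,
    the point used in \<open>dg_form_const\<close>.\<close>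
  let ?div = "\<lambda>j K. divergence (\<lambda>\<eta>. matrix_inv (edge_matrix (P (tm n + \<gamma> j * dt) K)) *v
    grid_velocity P (tm n + \<gamma> j * dt) K \<eta>) 0"
  have "0 \<in> (ref_cell :: (real ^ 'd) set)"
    by (simp add: ref_cell_def)
  then have J_stage: "J i K = (\<Sum>j<i. \<alpha> i j * J j K + \<beta> i j * dt * ?div j K * J j K)"
    if "i \<in> {1..s}" "K \<in> C" for i K
    using metric that unfolding stage_metric_terms_def by blast
  have poly: "u i K \<in> poly_space k" if "i \<le> s" "K \<in> C" for i K
    using scheme that by (simp add: ale_dg_step_def)
  have tested:
    "inner_ref_cell (\<lambda>\<xi>. J 0 K * u 0 K \<xi>) p =
      inner_ref_cell (\<lambda>\<xi>. det (edge_matrix (P (tm n) K)) * un K \<xi>) p"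
    "\<And>i. i \<in> {1..s} \<Longrightarrow> inner_ref_cell (\<lambda>\<xi>. J i K * u i K \<xi>) p =
      (\<Sum>j<i. \<alpha> i j * inner_ref_cell (\<lambda>\<xi>. J j K * u j K \<xi>) p) +
      (\<Sum>j<i. \<beta> i j * dt * dg_form f ghat B C conn P K (u j) p (J j K) (tm n + \<gamma> j * dt))"
    if K: "K \<in> C" and p: "p \<in> poly_space k" for K p
  proof -
    \<comment> \<open>The equations depend on \<open>v\<close> only through \<open>p\<close>, so the
      test space at one time is enough. At the time level \<open>tm n\<close>,
      \<open>moving_mesh\<close> provides a full \<open>simplicial_mesh\<close>, with disjoint
      cells.\<close>
    obtain v where "v \<in> dg_space k \<Omega> C (P (tm n))" "pulls_back_to (P (tm n) K) v p"
      unfolding P_n by (rule dg_test_function[OF mesh_n(2,1) K p])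
    then show "inner_ref_cell (\<lambda>\<xi>. J 0 K * u 0 K \<xi>) p =
        inner_ref_cell (\<lambda>\<xi>. det (edge_matrix (P (tm n) K)) * un K \<xi>) p"
      "\<And>i. i \<in> {1..s} \<Longrightarrow> inner_ref_cell (\<lambda>\<xi>. J i K * u i K \<xi>) p =
        (\<Sum>j<i. \<alpha> i j * inner_ref_cell (\<lambda>\<xi>. J j K * u j K \<xi>) p) +
        (\<Sum>j<i. \<beta> i j * dt * dg_form f ghat B C conn P K (u j) p (J j K) (tm n + \<gamma> j * dt))"
      using scheme n_in(1) K p unfolding ale_dg_step_def by blast+
  qed
  \<comment> \<open>All cells are treated at once, since the exterior traces of one cell read the
    earlier stages on its neighbours.\<close>
  have "\<forall>K\<in>C. \<forall>\<xi>\<in>ref_cell. u i K \<xi> = c" if "i \<le> s" for i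
    using that
  proof (induction i rule: less_induct)
    case (less i)
    show ?case
    proof (intro ballI)
      fix K and \<xi> :: "real ^ 'd" assume K: "K \<in> C" and \<xi>: "\<xi> \<in> ref_cell"
      show "u i K \<xi> = c"
      proof (rule poly_space_eq_const_by_testing[OF J_nonzero[OF less.prems K] poly[OF less.prems K] _ \<xi>])
        fix p :: "real ^ 'd \<Rightarrow> real" assume p: "p \<in> poly_space k"
        let ?I = "LINT \<xi>:ref_cell|lborel. p \<xi>"
        show "inner_ref_cell (\<lambda>\<xi>. J i K * u i K \<xi>) p = J i K * c * ?I"
        proof (cases "i = 0")
          case True
          have "inner_ref_cell (\<lambda>\<xi>. det (edge_matrix (P (tm n) K)) * un K \<xi>) p = J 0 K * c * ?I"
            unfolding J0[OF K] by (rule inner_ref_cell_const) (use init K in blast)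
          then show ?thesis
            using tested(1)[OF K p] True by simp
        next
          case False
          then have i: "i \<in> {1..s}"
            using less.prems by simp
          have const: "u j L \<zeta> = c" if "j < i" "L \<in> C" "\<zeta> \<in> ref_cell" for j L \<zeta>
            using less.IH[OF that(1)] that less.prems by simp
          have "inner_ref_cell (\<lambda>\<xi>. J j K * u j K \<xi>) p = J j K * c * ?I" if "j < i" for j
            by (rule inner_ref_cell_const) (rule const[OF that K])
          moreover have "dg_form f ghat B C conn P K (u j) p (J j K) (tm n + \<gamma> j * dt) =
              c * (?div j K * J j K) * ?I" if "j < i" for j
          proof -
            have j: "j < s" "j \<le> s"
              using that less.prems by auto
            show ?thesis
              unfolding P_def
            proof (rule dg_form_const[OF flux boundary stage_time[OF j(1)] _ J_nonzero[OF j(2) K] K p])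
              show "det (edge_matrix (slab_vertices tm conn X n (tm n + \<gamma> j * dt) L)) \<noteq> 0" if "L \<in> C" for L
                using det[OF stage_time[OF j(1)] that] by (simp add: P_def)
            qed (rule const[OF that])
          qed
          ultimately have "inner_ref_cell (\<lambda>\<xi>. J i K * u i K \<xi>) p =
              (\<Sum>j<i. \<alpha> i j * (J j K * c * ?I)) +
              (\<Sum>j<i. \<beta> i j * dt * (c * (?div j K * J j K) * ?I))"
            unfolding tested(2)[OF K p i] by simp
          also have "\<dots> = J i K * c * ?I"
            unfolding J_stage[OF i K] sum.distrib[symmetric] sum_distrib_right
            by (intro sum.cong) (simp_all add: algebra_simps)
          finally show ?thesis .
        qed
      qed
    qed
  qed
  then show ?thesis
    by blast
qed

end
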